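(* Let $(b_N)$ be a sequence of positive integers with $b_N\to\infty$ and $b_N=o(N)$. For each $N$ let $\sim$ be an equivalence relation on $\{1,\dots,N\}^2$ with $(p,q)\sim(q,p)$ for all $p,q$, satisfying, as $N\to\infty$, (O1) $\max_p\#\{(q,r,s)\in\{1,\dots,N\}^3:(p,q)\sim(r,s)\}=o(b_N^2)$; (O2) $\max_{p,q,r}\#\{s\in\{1,\dots,N\}:(p,q)\sim(r,s)\}\le B<\infty$ with $B$ independent of $N$; (O3) $\#\{(p,q,r)\in\{1,\dots,N\}^3:(p,q)\sim(q,r),\ r\neq p\}=o(b_N^2)$. Let $(X^{(N)}_{ij})_{1\le i,j\le N}$ be real random variables with $X^{(N)}_{ij}=X^{(N)}_{ji}$, $\mathbb EX^{(N)}_{ij}=0$, $\mathbb E(X^{(N)}_{ij})^2=1$, $\sup_N\max_{i,j}\mathbb E|X^{(N)}_{ij}|^k<\infty$ for all $k$, and such that for each $N$ the families $\{X^{(N)}_{pq}:(p,q)\in C\}$, $C$ ranging over the distinct $\sim$-classes, are mutually independent. Let $$A^{(N)}:=\frac{1}{\sqrt{2b_N}}\Big(\chi_{[0,b_N]}(|i-j|)\,X^{(N)}_{ij}\Big)_{1\le i,j\le N}.$$ Then for all $k\in\mathbb N$, $$\lim_{N\to\infty}\frac1N\mathbb E\big(\operatorname{tr}(A^{(N)})^k\big)=\begin{cases}C_{k/2}&k\text{ even},\\0&k\text{ odd},\end{cases}\qquad C_n=\frac{1}{n+1}\binom{2n}{n}.$$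
   Context: $\chi_{[0,b_N]}(|i-j|)$ equals $1$ if $|i-j|\le b_N$ and $0$ otherwise. *)

theory Defs
  imports "HOL-Probability.Probability" "HOL-Library.Landau_Symbols"
begin

text \<open>Square matrices of size N are represented as functions nat => nat => real,
  indexed by 1..N (entries outside are irrelevant).\<close>

definition sqmat_mult :: "nat \<Rightarrow> (nat \<Rightarrow> nat \<Rightarrow> real) \<Rightarrow> (nat \<Rightarrow> nat \<Rightarrow> real) \<Rightarrow> (nat \<Rightarrow> nat \<Rightarrow> real)" where
  "sqmat_mult N A B = (\<lambda>i j. \<Sum>l\<in>{1..N}. A i l * B l j)"

fun sqmat_pow :: "nat \<Rightarrow> (nat \<Rightarrow> nat \<Rightarrow> real) \<Rightarrow> nat \<Rightarrow> (nat \<Rightarrow> nat \<Rightarrow> real)" where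
  "sqmat_pow N A 0 = (\<lambda>i j. if i = j then 1 else 0)"
| "sqmat_pow N A (Suc k) = sqmat_mult N (sqmat_pow N A k) A"

definition sqmat_trace :: "nat \<Rightarrow> (nat \<Rightarrow> nat \<Rightarrow> real) \<Rightarrow> real" where
  "sqmat_trace N A = (\<Sum>i\<in>{1..N}. A i i)"

definition catalan :: "nat \<Rightarrow> real" where
  "catalan n = real ((2 * n) choose n) / real (n + 1)"

definition band_matrix :: "nat \<Rightarrow> (nat \<Rightarrow> nat \<Rightarrow> real) \<Rightarrow> (nat \<Rightarrow> nat \<Rightarrow> real)" where
  "band_matrix bN Y = (\<lambda>i j. (if \<bar>int i - int j\<bar> \<le> int bN then Y i j else 0) / sqrt (2 * real bN))"

end

theory Submission
  imports Defs "HOL-Real_Asymp.Real_Asymp"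
begin

text \<open>
  Expand the trace over closed walks in the band and label each edge by its \<open>\<sim>\<close>-class. By
  independence a walk in which some class occurs exactly once contributes \<open>0\<close>. By (O2) the walks
  realising a given label word with \<open>m\<close> distinct letters number \<open>O(N b\<^sup>m)\<close>, so if no letter is
  isolated only the words in which every letter occurs exactly twice survive.

  Such a word contains two occurrences of a letter \<open>a\<close> with distinct letters in between. If there is
  something in between, (O1) fixes both ends of that stretch of the walk, and a factor \<open>b\<close> is lost.
  Otherwise \<open>a a\<close> is a factor of the word; by (O3) the walk backtracks along this edge up to a
  negligible set, and the backtracking can be cut out. Hence, up to \<open>o(N b\<^bsup>k/2\<^esup>)\<close> walks, a
  contributing walk is the contour of a plane tree. Such walks have expectation \<open>1\<close>, each tree with
  \<open>k/2\<close> edges is traversed by about \<open>N (2b)\<^bsup>k/2\<^esup>\<close> of them, and the trees, coded by Dyck words, are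
  counted by the Catalan numbers. Closedness of the walk is never needed for the upper bounds.

  Of the band only two properties matter: its degrees are at most \<open>2b + 1\<close>, with equality away from
  the ends. The counting therefore takes place in an arbitrary graph with degrees at most \<open>\<Delta>\<close>.
\<close>

section \<open>Dyck words\<close>

fun dyck :: "nat \<Rightarrow> bool list \<Rightarrow> bool" where
  "dyck h [] \<longleftrightarrow> h = 0"
| "dyck h (True # d) \<longleftrightarrow> dyck (Suc h) d"
| "dyck h (False # d) \<longleftrightarrow> h > 0 \<and> dyck (h - 1) d"

lemma dyck_length: "dyck h d \<Longrightarrow> length d = 2 * count_list d True + h"
  by (induction h d rule: dyck.induct) auto

definition dyck_words :: "nat \<Rightarrow> nat \<Rightarrow> bool list set" where
  "dyck_words n h = {d. length d = n \<and> dyck h d}"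

lemma finite_dyck_words [simp]: "finite (dyck_words n h)"
  by (rule finite_subset[OF _ finite_lists_length_eq[of UNIV n]]) (auto simp: dyck_words_def)

lemma dyck_words_Suc:
  "dyck_words (Suc n) h = (#) True ` dyck_words n (Suc h)
     \<union> (if h = 0 then {} else (#) False ` dyck_words n (h - 1))" (is "?lhs = ?rhs")
proof (intro set_eqI iffI)
  fix d assume "d \<in> ?lhs"
  then obtain c e where "d = c # e" "length e = n" "dyck h (c # e)"
    by (auto simp: dyck_words_def length_Suc_conv)
  then show "d \<in> ?rhs"
    by (cases c) (auto simp: dyck_words_def)
qed (auto simp: dyck_words_def split: if_splits)

lemma card_dyck_words_Suc:
  "card (dyck_words (Suc n) h)
     = card (dyck_words n (Suc h)) + (if h = 0 then 0 else card (dyck_words n (h - 1)))"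
proof -
  have "(#) True ` dyck_words n (Suc h) \<inter> (#) False ` dyck_words n (h - 1) = {}"
    by auto
  then show ?thesis
    unfolding dyck_words_Suc by (auto simp: card_Un_disjoint card_image)
qed

text \<open>The ballot numbers of the reflection principle; the index \<open>j = (n + h) / 2\<close> keeps the second
  binomial coefficient free of truncated subtraction.\<close>

lemma card_dyck_words:
  "n + h = 2 * j \<Longrightarrow> int (card (dyck_words n h)) = int (n choose j) - int (n choose Suc j)"
proof (induction n arbitrary: h j)
  case 0
  have "dyck_words 0 h = (if h = 0 then {[]} else {})"
    by (auto simp: dyck_words_def)
  with 0 show ?case
    by (cases j) auto
next
  case (Suc n)
  then obtain i where j_eq: "j = Suc i"
    by (cases j) auto
  have card_up: "int (card (dyck_words n (Suc h))) = int (n choose j) - int (n choose Suc j)"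
    using Suc.IH[of "Suc h" j] Suc.prems by simp
  show ?case
  proof (cases h)
    case 0
    then have "n choose i = n choose j"
      using binomial_symmetric[of j n] Suc.prems j_eq by simp
    with card_up 0 j_eq show ?thesis
      by (simp add: card_dyck_words_Suc)
  next
    case h_eq: (Suc h')
    have "int (card (dyck_words n h')) = int (n choose i) - int (n choose Suc i)"
      using Suc.IH[of h' i] Suc.prems h_eq j_eq by simp
    with card_up h_eq j_eq show ?thesis
      by (simp add: card_dyck_words_Suc)
  qed
qed

lemma card_dyck_words_catalan: "real (card (dyck_words (2 * n) 0)) = catalan n"
proof -
  have "int (card (dyck_words (2 * n) 0)) = int (2 * n choose n) - int (2 * n choose Suc n)"
    by (rule card_dyck_words) simp
  then have ballot:
    "real (card (dyck_words (2 * n) 0)) = real (2 * n choose n) - real (2 * n choose Suc n)"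
    by linarith
  have "Suc n * (2 * n choose Suc n) = n * (2 * n choose n)"
    using binomial_absorb_comp[of "2 * n" n] binomial_absorption[of n "2 * n"]
    by (metis add_diff_cancel_left' mult_2)
  then have "real (Suc n) * real (2 * n choose Suc n) = real n * real (2 * n choose n)"
    by (metis of_nat_mult)
  then show ?thesis
    unfolding ballot catalan_def by (simp add: field_simps)
qed

lemma dyck_words_odd: "odd n \<Longrightarrow> dyck_words n 0 = {}"
  using dyck_length[of 0] by (auto simp: dyck_words_def)

corollary card_dyck_words_eq_catalan_if:
  "real (card (dyck_words k 0)) = (if even k then catalan (k div 2) else 0)"
  using card_dyck_words_catalan[of "k div 2"] dyck_words_odd[of k] by auto


section \<open>Stack parsing\<close>

fun parse :: "'l list \<Rightarrow> bool list \<Rightarrow> 'l list \<Rightarrow> bool" where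
  "parse s [] [] \<longleftrightarrow> s = []"
| "parse s (True # d) (a # w) \<longleftrightarrow> parse (a # s) d w"
| "parse (t # s) (False # d) (a # w) \<longleftrightarrow> a = t \<and> parse s d w"
| "parse _ _ _ \<longleftrightarrow> False"

lemma parse_length: "parse s d w \<Longrightarrow> length d = length w"
  by (induction s d w rule: parse.induct) auto

lemma parse_even_count: "parse s d w \<Longrightarrow> even (count_list w a + count_list s a)"
  by (induction s d w rule: parse.induct) auto

lemma parse_count_le: "parse s d w \<Longrightarrow> count_list s a \<le> count_list w a"
  by (induction s d w rule: parse.induct) (auto split: if_splits)

lemma parse_push_iff:
  assumes "parse s (c # d) (a # w)" and "count_list (a # w) a + count_list s a \<le> 2"
  shows "c \<longleftrightarrow> a \<notin> set s"
proof (cases c)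
  case True
  then have "count_list s a < count_list w a"
    using assms(1) parse_count_le[of "a # s" d w a] by simp
  with assms(2) have "count_list s a = 0"
    by simp
  with True show ?thesis
    by (simp add: count_list_0_iff)
next
  case False
  with assms(1) show ?thesis
    by (cases s) auto
qed

lemma parse_unique:
  assumes "parse s d w" "parse s d' w" "\<And>a. count_list w a + count_list s a \<le> 2"
  shows "d = d'"
  using assms
proof (induction w arbitrary: s d d')
  case Nil
  then show ?case
    by (metis parse_length length_0_conv)
next
  case (Cons a w)
  obtain c e c' e' where d_eq: "d = c # e" "d' = c' # e'"
    using Cons.prems(1,2) parse_length by (metis length_Suc_conv)
  have "c = c'"
    using parse_push_iff Cons.prems d_eq by metis
  moreover have "e = e'"
  proof (cases c)
    case True
    have "count_list w b + count_list (a # s) b \<le> 2" for b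
      using Cons.prems(3)[of b] by (simp split: if_splits)
    then show ?thesis
      using Cons.IH[of "a # s" e e'] Cons.prems(1,2) d_eq \<open>c = c'\<close> True by simp
  next
    case False
    then obtain t where pop: "s = a # t" "parse t e w" "parse t e' w"
      using Cons.prems(1,2) d_eq \<open>c = c'\<close> by (cases s) auto
    have "count_list w b + count_list t b \<le> 2" for b
      using Cons.prems(3)[of b] pop(1) by (simp split: if_splits)
    then show ?thesis
      using Cons.IH pop(2,3) by blast
  qed
  ultimately show ?case
    using d_eq by simp
qed


section \<open>Contour walks\<close>

fun edges :: "'v list \<Rightarrow> ('v \<times> 'v) list" where
  "edges (x # y # p) = (x, y) # edges (y # p)"
| "edges _ = []"

lemma length_edges [simp]: "length (edges p) = length p - 1"
  by (induction p rule: edges.induct) auto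

lemma edges_Cons: "p \<noteq> [] \<Longrightarrow> edges (x # p) = (x, hd p) # edges p"
  by (cases p) auto

lemma edges_snoc: "p \<noteq> [] \<Longrightarrow> edges (p @ [x]) = edges p @ [(last p, x)]"
  by (induction p rule: edges.induct) auto

lemma edges_append: "edges (p @ x # q) = edges (p @ [x]) @ edges (x # q)"
  by (induction p rule: edges.induct) auto

lemma edges_rev: "edges (rev p) = rev (map prod.swap (edges p))"
proof (induction p rule: edges.induct)
  case (1 x y p)
  then show ?case
    using edges_snoc[of "rev p @ [y]" x] by simp
qed simp_all

lemma successively_edges_iff: "successively P p \<longleftrightarrow> (\<forall>(x, y)\<in>set (edges p). P x y)"
  by (induction p rule: edges.induct) auto

lemma set_edges_subset: "set (edges p) \<subseteq> set p \<times> set p"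
  by (induction p rule: edges.induct) auto

text \<open>\<open>contour st d p\<close>: after having arrived at \<open>hd p\<close> from the root through the vertices on the
  stack \<open>st\<close>, the walk \<open>p\<close> completes the depth-first traversal of a plane tree; \<open>True\<close> in \<open>d\<close> is a
  step away from the root and \<open>False\<close> the return to the parent.\<close>

fun contour :: "'v list \<Rightarrow> bool list \<Rightarrow> 'v list \<Rightarrow> bool" where
  "contour st [] [v] \<longleftrightarrow> st = []"
| "contour st (True # d) (v # x # p) \<longleftrightarrow> contour (v # st) d (x # p)"
| "contour (u # st) (False # d) (v # x # p) \<longleftrightarrow> x = u \<and> contour st d (x # p)"
| "contour _ _ _ \<longleftrightarrow> False"

lemma contour_dyck: "contour st d p \<Longrightarrow> dyck (length st) d"
  by (induction st d p rule: contour.induct) auto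

lemma contour_length: "contour st d p \<Longrightarrow> length p = Suc (length d)"
  by (induction st d p rule: contour.induct) auto

lemma contour_last: "contour st d p \<Longrightarrow> last p = last (hd p # st)"
  by (induction st d p rule: contour.induct) auto

lemma contour_parse:
  assumes "\<And>x y. f (x, y) = f (y, x)"
  shows "contour st d p \<Longrightarrow> parse (map f (edges (hd p # st))) d (map f (edges p))"
  by (induction st d p rule: contour.induct) (auto simp: assms)

lemma contour_insert_backtrack:
  "contour st d (p @ x # q) \<Longrightarrow> \<exists>d'. contour st d' (p @ x # y # x # q)"
proof (induction p arbitrary: st d)
  case Nil
  then have "contour st (True # False # d) (x # y # x # q)"
    by simp
  then show ?case
    by (intro exI[of _ "True # False # d"]) simp
next
  case (Cons v p)
  obtain c e where d_eq: "d = c # e"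
    using contour_length[OF Cons.prems] by (cases d) auto
  obtain z r r' where tails: "p @ x # q = z # r" "p @ x # y # x # q = z # r'"
    by (cases p) auto
  show ?case
  proof (cases c)
    case True
    with Cons.prems d_eq tails(1) have "contour (v # st) e (p @ x # q)"
      by simp
    then obtain d' where "contour (v # st) d' (p @ x # y # x # q)"
      using Cons.IH by blast
    then have "contour st (True # d') ((v # p) @ x # y # x # q)"
      by (simp add: tails(2))
    then show ?thesis ..
  next
    case False
    with Cons.prems d_eq tails(1) obtain st' where pop: "st = z # st'" "contour st' e (p @ x # q)"
      by (cases st) auto
    then obtain d' where "contour st' d' (p @ x # y # x # q)"
      using Cons.IH by blast
    then have "contour st (False # d') ((v # p) @ x # y # x # q)"
      by (simp add: pop(1) tails(2))
    then show ?thesis ..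
  qed
qed

definition contours :: "'v list \<Rightarrow> bool list set" where
  "contours p = {d. contour [] d p}"

lemma contours_eq: "length p = Suc k \<Longrightarrow> contours p = {d \<in> dyck_words k 0. contour [] d p}"
  using contour_dyck contour_length by (fastforce simp: contours_def dyck_words_def)


section \<open>Walks in graphs of bounded degree\<close>

lemma card_UN_le_mult:
  "finite I \<Longrightarrow> (\<And>i. i \<in> I \<Longrightarrow> card (A i) \<le> n) \<Longrightarrow> card (\<Union>i\<in>I. A i) \<le> card I * n"
  using order_trans[OF card_UN_le sum_bounded_above[of I "\<lambda>i. card (A i)" n]] by simp

locale finite_graph =
  fixes V :: "'v set" and adj :: "'v \<Rightarrow> 'v \<Rightarrow> bool"
  assumes finite_V [simp]: "finite V"
    and adj_commute: "adj x y \<longleftrightarrow> adj y x"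
begin

definition neighbours :: "'v \<Rightarrow> 'v set" where
  "neighbours v = {x \<in> V. adj v x}"

definition walks :: "nat \<Rightarrow> 'v list set" where
  "walks k = {p. length p = Suc k \<and> set p \<subseteq> V \<and> successively adj p}"

definition walks_from :: "'v \<Rightarrow> nat \<Rightarrow> 'v list set" where
  "walks_from v k = {p \<in> walks k. hd p = v}"

definition closed_walks :: "nat \<Rightarrow> 'v list set" where
  "closed_walks k = {p \<in> walks k. last p = hd p}"

definition contour_walks :: "'v list \<Rightarrow> bool list \<Rightarrow> 'v \<Rightarrow> 'v list set" where
  "contour_walks st d v = {p \<in> walks_from v (length d). contour st d p}"

lemma finite_neighbours [simp]: "finite (neighbours v)"
  by (simp add: neighbours_def)

lemma finite_walks [simp]: "finite (walks k)"
  by (rule finite_subset[OF _ finite_lists_length_eq[of V "Suc k"]]) (auto simp: walks_def)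

lemma finite_walks_from [simp]: "finite (walks_from v k)"
  by (simp add: walks_from_def)

lemma finite_closed_walks [simp]: "finite (closed_walks k)"
  by (simp add: closed_walks_def)

lemma Nil_notin_walks [simp]: "[] \<notin> walks k"
  by (simp add: walks_def)

lemma walks_length: "p \<in> walks k \<Longrightarrow> length p = Suc k"
  by (simp add: walks_def)

lemma walks_Cons_iff: "v # p \<in> walks (Suc k) \<longleftrightarrow> v \<in> V \<and> adj v (hd p) \<and> p \<in> walks k"
  by (auto simp: walks_def successively_Cons)

lemma walks_snoc_iff: "p @ [v] \<in> walks (Suc k) \<longleftrightarrow> p \<in> walks k \<and> v \<in> V \<and> adj (last p) v"
  by (auto simp: walks_def successively_append_iff)

lemma rev_walks_iff [simp]: "rev p \<in> walks k \<longleftrightarrow> p \<in> walks k"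
  by (simp add: walks_def flip: adj_commute)

lemma walks_takeI:
  assumes "p \<in> walks k" "j \<le> k"
  shows "take (Suc j) p \<in> walks j"
proof -
  have "successively adj (take (Suc j) p @ drop (Suc j) p)"
    using assms(1) by (simp add: walks_def)
  then have "successively adj (take (Suc j) p)"
    unfolding successively_append_iff by blast
  with assms show ?thesis
    by (auto simp: walks_def dest: in_set_takeD)
qed

lemma hd_walks: "p \<in> walks k \<Longrightarrow> hd p \<in> V"
  by (cases p) (auto simp: walks_def)

lemma last_walks: "p \<in> walks k \<Longrightarrow> last p \<in> V"
  by (cases p rule: rev_cases) (auto simp: walks_def)

lemma set_edges_walks: "p \<in> walks k \<Longrightarrow> set (edges p) \<subseteq> V \<times> V"
  using set_edges_subset[of p] by (auto simp: walks_def)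

lemma walks_from_outside: "v \<notin> V \<Longrightarrow> walks_from v k = {}"
  using hd_walks by (auto simp: walks_from_def)

lemma walks_from_0: "v \<in> V \<Longrightarrow> walks_from v 0 = {[v]}"
  by (auto simp: walks_from_def walks_def length_Suc_conv)

lemma walks_from_Suc:
  assumes "v \<in> V"
  shows "walks_from v (Suc k) = (\<Union>x\<in>neighbours v. (#) v ` walks_from x k)"
proof (intro set_eqI iffI)
  fix p assume p: "p \<in> walks_from v (Suc k)"
  then obtain q where "p = v # q" "hd q \<in> neighbours v" "q \<in> walks_from (hd q) k"
    by (cases p) (auto simp: walks_from_def walks_Cons_iff neighbours_def hd_walks)
  then show "p \<in> (\<Union>x\<in>neighbours v. (#) v ` walks_from x k)"
    by blast
qed (use assms in \<open>auto simp: walks_from_def walks_Cons_iff neighbours_def\<close>)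

lemma sum_walks_from_group_last:
  "(\<Sum>l\<in>V. \<Sum>p | p \<in> walks_from v k \<and> last p = l. f p) = (\<Sum>p\<in>walks_from v k. f p)"
  by (rule sum.group) (auto simp: walks_from_def dest: last_walks)

lemma sum_closed_walks:
  "(\<Sum>p\<in>closed_walks k. f p) = (\<Sum>v\<in>V. \<Sum>p | p \<in> walks_from v k \<and> last p = v. f p)"
proof -
  have "(\<Sum>p\<in>closed_walks k. f p) = (\<Sum>v\<in>V. \<Sum>p | p \<in> closed_walks k \<and> hd p = v. f p)"
    by (rule sum.group[symmetric]) (auto simp: closed_walks_def dest: hd_walks)
  also have "\<dots> = (\<Sum>v\<in>V. \<Sum>p | p \<in> walks_from v k \<and> last p = v. f p)"
    by (intro sum.cong refl) (auto simp: walks_from_def closed_walks_def)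
  finally show ?thesis .
qed

lemma sum_walks_from_Suc_last:
  assumes "x \<in> V"
  shows "(\<Sum>p | p \<in> walks_from v (Suc k) \<and> last p = x. f p)
    = (\<Sum>p | p \<in> walks_from v k \<and> adj (last p) x. f (p @ [x]))"
proof (rule sum.reindex_bij_witness[of _ "\<lambda>p. p @ [x]" butlast])
  fix p assume "p \<in> {p. p \<in> walks_from v (Suc k) \<and> last p = x}"
  then obtain q where "p = q @ [x]" "q \<noteq> []" "q \<in> walks k" "adj (last q) x" "hd q = v"
    by (cases p rule: rev_cases)
      (auto simp: walks_from_def walks_snoc_iff hd_append split: if_splits)
  then show "butlast p @ [x] = p" and "butlast p \<in> {p. p \<in> walks_from v k \<and> adj (last p) x}"
    and "f (butlast p @ [x]) = f p"
    by (simp_all add: walks_from_def)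
next
  fix p assume "p \<in> {p. p \<in> walks_from v k \<and> adj (last p) x}"
  then have "p \<noteq> []" "p @ [x] \<in> walks (Suc k)" "hd p = v"
    using assms by (auto simp: walks_from_def walks_snoc_iff)
  then show "p @ [x] \<in> {p. p \<in> walks_from v (Suc k) \<and> last p = x}" and "butlast (p @ [x]) = p"
    by (simp_all add: walks_from_def)
qed

lemma contour_walks_outside: "v \<notin> V \<Longrightarrow> contour_walks st d v = {}"
  by (simp add: contour_walks_def walks_from_outside)

lemma contour_walks_Nil: "v \<in> V \<Longrightarrow> contour_walks st [] v = (if st = [] then {[v]} else {})"
  by (auto simp: contour_walks_def walks_from_0)

lemma contour_walks_True:
  assumes "v \<in> V"
  shows "contour_walks st (True # d) v = (\<Union>x\<in>neighbours v. (#) v ` contour_walks (v # st) d x)"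
proof -
  have "contour st (True # d) (v # p) \<longleftrightarrow> contour (v # st) d p" if "p \<in> walks_from x n" for x n p
    using that by (cases p) (auto simp: walks_from_def walks_def)
  then show ?thesis
    unfolding contour_walks_def using assms by (auto simp: walks_from_Suc)
qed

lemma contour_walks_False:
  assumes "v \<in> V"
  shows "contour_walks (u # st) (False # d) v
     = (if u \<in> neighbours v then (#) v ` contour_walks st d u else {})"
proof -
  have "contour (u # st) (False # d) (v # p) \<longleftrightarrow> x = u \<and> contour st d p"
    if "p \<in> walks_from x n" for x n p
    using that by (cases p) (auto simp: walks_from_def walks_def)
  then show ?thesis
    unfolding contour_walks_def using assms by (auto simp: walks_from_Suc)
qed

lemma contour_walks_False_Nil: "contour_walks [] (False # d) v = {}"
  by (auto simp: contour_walks_def)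

lemma card_contour_walks_True:
  "v \<in> V \<Longrightarrow>
     card (contour_walks st (True # d) v) = (\<Sum>x\<in>neighbours v. card (contour_walks (v # st) d x))"
  unfolding contour_walks_True
  by (subst card_UN_disjoint) (auto simp: card_image contour_walks_def walks_from_def)

lemma sum_card_contour_walks:
  "(\<Sum>v\<in>V. card (contour_walks [] d v)) = card {p \<in> closed_walks (length d). contour [] d p}"
proof -
  have "last p = hd p" if "contour [] d p" for p
    using contour_last[OF that] by simp
  then have "{p \<in> closed_walks (length d). contour [] d p} = (\<Union>v\<in>V. contour_walks [] d v)"
    using hd_walks by (auto simp: contour_walks_def walks_from_def closed_walks_def)
  also have "card \<dots> = (\<Sum>v\<in>V. card (contour_walks [] d v))"
    by (rule card_UN_disjoint) (auto simp: contour_walks_def walks_from_def)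
  finally show ?thesis ..
qed

end

locale bounded_degree_graph = finite_graph V adj
  for V :: "'v set" and adj :: "'v \<Rightarrow> 'v \<Rightarrow> bool" +
  fixes \<Delta> :: nat
  assumes degree_le: "v \<in> V \<Longrightarrow> card {x \<in> V. adj v x} \<le> \<Delta>"
    and \<Delta>_pos: "0 < \<Delta>"
begin

lemma card_neighbours_le: "v \<in> V \<Longrightarrow> card (neighbours v) \<le> \<Delta>"
  using degree_le by (simp add: neighbours_def)

lemma card_walks_from_le: "card (walks_from v k) \<le> \<Delta> ^ k"
proof (induction k arbitrary: v)
  case 0
  show ?case
    by (cases "v \<in> V") (simp_all add: walks_from_0 walks_from_outside)
next
  case (Suc k)
  show ?case
  proof (cases "v \<in> V")
    case True
    have "card (walks_from v (Suc k)) \<le> card (neighbours v) * \<Delta> ^ k"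
      unfolding walks_from_Suc[OF True]
      by (intro card_UN_le_mult order_trans[OF card_image_le Suc.IH]) simp_all
    also have "\<dots> \<le> \<Delta> ^ Suc k"
      using card_neighbours_le[OF True] by simp
    finally show ?thesis .
  qed (simp add: walks_from_outside)
qed

lemma card_contour_walks_le: "card (contour_walks st d v) \<le> \<Delta> ^ count_list d True"
proof (induction d arbitrary: v st)
  case Nil
  show ?case
    by (cases "v \<in> V") (simp_all add: contour_walks_Nil contour_walks_outside)
next
  case (Cons c d)
  consider "v \<notin> V" | "\<not> c" "st = []"
    | (up) "v \<in> V" c | (down) u st' where "v \<in> V" "\<not> c" "st = u # st'"
    by (cases st) auto
  then show ?case
  proof cases
    case up
    then have "card (contour_walks st (c # d) v) \<le> card (neighbours v) * \<Delta> ^ count_list d True"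
      using sum_bounded_above[of "neighbours v", OF Cons.IH] by (simp add: card_contour_walks_True)
    also have "\<dots> \<le> \<Delta> * \<Delta> ^ count_list d True"
      using card_neighbours_le[OF up(1)] by simp
    finally show ?thesis
      using up by simp
  next
    case down
    then show ?thesis
      using Cons.IH by (simp add: contour_walks_False card_image)
  qed (simp_all add: contour_walks_outside contour_walks_False_Nil)
qed

primrec regular_interior :: "nat \<Rightarrow> 'v set" where
  "regular_interior 0 = V"
| "regular_interior (Suc m) = {v \<in> V. card (neighbours v) = \<Delta> \<and> neighbours v \<subseteq> regular_interior m}"

lemma regular_interior_subset: "regular_interior m \<subseteq> V"
  by (cases m) auto

lemma regular_interior_Suc_subset: "regular_interior (Suc m) \<subseteq> regular_interior m"
  by (induction m) auto

lemma card_contour_walks_interior: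
  assumes "set (v # st) \<subseteq> regular_interior (length d)" and "successively adj (v # st)"
    and "dyck (length st) d"
  shows "card (contour_walks st d v) = \<Delta> ^ count_list d True"
  using assms
proof (induction d arbitrary: v st)
  case Nil
  then show ?case
    by (simp add: contour_walks_Nil)
next
  case (Cons c d)
  have inner: "set (v # st) \<subseteq> regular_interior (length d)"
    using Cons.prems(1) regular_interior_Suc_subset[of "length d"]
    by (simp del: regular_interior.simps) blast
  have v_in_V: "v \<in> V"
    and regular: "card (neighbours v) = \<Delta>" "neighbours v \<subseteq> regular_interior (length d)"
    using Cons.prems(1) by auto
  show ?case
  proof (cases c)
    case True
    have "card (contour_walks (v # st) d x) = \<Delta> ^ count_list d True" if "x \<in> neighbours v" for x
    proof (rule Cons.IH)
      show "set (x # v # st) \<subseteq> regular_interior (length d)"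
        using that inner regular(2) by auto
      show "successively adj (x # v # st)"
        using that Cons.prems(2) adj_commute by (auto simp: neighbours_def)
      show "dyck (length (v # st)) d"
        using Cons.prems(3) True by simp
    qed
    then show ?thesis
      using True v_in_V regular(1) by (simp add: card_contour_walks_True)
  next
    case False
    then obtain u st' where st_eq: "st = u # st'"
      using Cons.prems(3) by (cases st) auto
    then have "u \<in> neighbours v"
      using Cons.prems(2) inner regular_interior_subset by (auto simp: neighbours_def)
    moreover have "card (contour_walks st' d u) = \<Delta> ^ count_list d True"
      using Cons.prems inner False st_eq by (intro Cons.IH) auto
    ultimately show ?thesis
      using False v_in_V st_eq by (simp add: contour_walks_False card_image)
  qed
qed

lemma sum_card_contour_walks_bounds:
  assumes "dyck 0 d"
  shows "(\<Sum>v\<in>V. card (contour_walks [] d v)) \<le> card V * \<Delta> ^ count_list d True"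
    and "card (regular_interior (length d)) * \<Delta> ^ count_list d True
      \<le> (\<Sum>v\<in>V. card (contour_walks [] d v))"
proof -
  show "(\<Sum>v\<in>V. card (contour_walks [] d v)) \<le> card V * \<Delta> ^ count_list d True"
    using sum_bounded_above[of V, OF card_contour_walks_le] by simp
  have "card (regular_interior (length d)) * \<Delta> ^ count_list d True
      = (\<Sum>v\<in>regular_interior (length d). card (contour_walks [] d v))"
    using assms by (simp add: card_contour_walks_interior)
  also have "\<dots> \<le> (\<Sum>v\<in>V. card (contour_walks [] d v))"
    by (intro sum_mono2 regular_interior_subset) simp_all
  finally show "card (regular_interior (length d)) * \<Delta> ^ count_list d True
      \<le> (\<Sum>v\<in>V. card (contour_walks [] d v))" .
qed

lemma contour_walks_fraction:
  assumes "V \<noteq> {}" and dyck_d: "d \<in> dyck_words k 0"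
  shows "\<bar>real (card {p \<in> closed_walks k. contour [] d p})
      / (real (card V) * sqrt (real \<Delta>) ^ k) - 1\<bar>
    \<le> 1 - real (card (regular_interior k)) / real (card V)"
proof -
  let ?n = "real (card V)" and ?s = "sqrt (real \<Delta>) ^ k"
  let ?c = "card {p \<in> closed_walks k. contour [] d p}"
  have positive: "0 < ?n" "0 < ?s"
    using assms(1) \<Delta>_pos by (simp_all add: card_gt_0_iff)
  have "length d = k" and "dyck 0 d"
    using dyck_d by (simp_all add: dyck_words_def)
  then have k_eq: "k = 2 * count_list d True"
    using dyck_length by fastforce
  have \<Delta>_power: "real (\<Delta> ^ count_list d True) = ?s"
    by (subst k_eq) (simp add: power_mult)
  have "?c \<le> card V * \<Delta> ^ count_list d True"
    and "card (regular_interior k) * \<Delta> ^ count_list d True \<le> ?c"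
    using sum_card_contour_walks_bounds[OF \<open>dyck 0 d\<close>] \<open>length d = k\<close>
    by (simp_all add: sum_card_contour_walks)
  then have "real ?c \<le> ?n * ?s" "real (card (regular_interior k)) * ?s \<le> real ?c"
    unfolding \<Delta>_power[symmetric] of_nat_mult[symmetric] of_nat_le_iff .
  then have "real ?c / (?n * ?s) \<le> 1" "real (card (regular_interior k)) / ?n \<le> real ?c / (?n * ?s)"
    using positive by (simp_all add: field_simps)
  then show ?thesis
    by (simp add: abs_le_iff)
qed

lemma sum_card_contours_fraction:
  assumes "V \<noteq> {}"
  shows "\<bar>(\<Sum>p\<in>closed_walks k. real (card (contours p))) / (real (card V) * sqrt (real \<Delta>) ^ k)
      - real (card (dyck_words k 0))\<bar>
    \<le> real (card (dyck_words k 0)) * (1 - real (card (regular_interior k)) / real (card V))"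
proof -
  let ?W = "\<lambda>d. {p \<in> closed_walks k. contour [] d p}" and ?t = "real (card V) * sqrt (real \<Delta>) ^ k"
  have "(\<Sum>p\<in>closed_walks k. card (contours p))
      = (\<Sum>p\<in>closed_walks k. card {d \<in> dyck_words k 0. contour [] d p})"
    by (intro sum.cong refl arg_cong[of _ _ card] contours_eq)
      (simp add: closed_walks_def walks_length)
  also have "\<dots> = (\<Sum>d\<in>dyck_words k 0. card (?W d))"
    by (rule sum_multicount_gen) simp_all
  finally have "(\<Sum>p\<in>closed_walks k. real (card (contours p)))
      = (\<Sum>d\<in>dyck_words k 0. real (card (?W d)))"
    unfolding of_nat_sum[symmetric] of_nat_eq_iff .
  then have "(\<Sum>p\<in>closed_walks k. real (card (contours p))) / ?t - real (card (dyck_words k 0))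
      = (\<Sum>d\<in>dyck_words k 0. real (card (?W d)) / ?t - 1)"
    by (simp add: sum_divide_distrib sum_subtractf)
  also have "\<bar>\<dots>\<bar> \<le> (\<Sum>d\<in>dyck_words k 0. 1 - real (card (regular_interior k)) / real (card V))"
    by (rule order_trans[OF sum_abs sum_mono[OF contour_walks_fraction[OF assms]]])
  finally show ?thesis
    by simp
qed

end


section \<open>Walks realising a label word\<close>

lemma count_list_map: "count_list (map g es) c = length (filter (\<lambda>e. g e = c) es)"
  by (induction es) auto

lemma not_distinct_decomp_innermost:
  "\<not> distinct w \<Longrightarrow> \<exists>u a x v. w = u @ a # x @ a # v \<and> distinct (a # x)"
proof (induction w)
  case (Cons c w)
  show ?case
  proof (cases "distinct w")
    case True
    with Cons.prems have "c \<in> set w"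
      by simp
    then obtain x v where "w = x @ c # v" "c \<notin> set x"
      by (meson split_list_first)
    with True show ?thesis
      by (intro exI[of _ "[]"] exI[of _ c] exI[of _ x] exI[of _ v]) simp
  next
    case False
    with Cons.IH obtain u a x v where "w = u @ a # x @ a # v" "distinct (a # x)"
      by blast
    then show ?thesis
      by (intro exI[of _ "c # u"] exI[of _ a] exI[of _ x] exI[of _ v]) simp
  qed
qed simp

definition pair_word :: "'l list \<Rightarrow> bool" where
  "pair_word w \<longleftrightarrow> (\<forall>a\<in>set w. count_list w a = 2)"

lemma pair_wordI:
  assumes "\<And>a. a \<in> set w \<Longrightarrow> 2 \<le> count_list w a" and "length w \<le> 2 * card (set w)"
  shows "pair_word w"
  unfolding pair_word_def
proof (rule ccontr)
  assume "\<not> (\<forall>a\<in>set w. count_list w a = 2)"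
  then obtain a where a: "a \<in> set w" "count_list w a \<noteq> 2"
    by blast
  with assms(1)[OF a(1)] have "2 < count_list w a"
    by linarith
  with a(1) have "(\<Sum>a\<in>set w. 2) < (\<Sum>a\<in>set w. count_list w a)"
    using assms(1) by (intro sum_strict_mono_ex1) auto
  also have "\<dots> = length w"
    by (simp add: sum_count_set)
  finally show False
    using assms(2) by simp
qed

lemma pair_word_length: "pair_word w \<Longrightarrow> length w = 2 * card (set w)"
  using sum_count_set[of w "set w"] by (simp add: pair_word_def)

lemma pair_word_distinct_iff: "pair_word w \<Longrightarrow> distinct w \<longleftrightarrow> w = []"
  using pair_word_length[of w] distinct_card[of w] by auto

lemma pair_word_remove_pair:
  assumes "pair_word (u @ a # a # v)"
  shows "a \<notin> set (u @ v)" and "pair_word (u @ v)"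
proof -
  have "count_list (u @ a # a # v) a = 2"
    using assms unfolding pair_word_def by simp
  then have "count_list (u @ v) a = 0"
    by simp
  then show a: "a \<notin> set (u @ v)"
    by (simp only: count_list_0_iff not_False_eq_True)
  have "count_list (u @ v) c = count_list (u @ a # a # v) c" if "c \<in> set (u @ v)" for c
    using a that by auto
  then show "pair_word (u @ v)"
    using assms by (auto simp: pair_word_def)
qed

definition coherent :: "('e \<times> 'e) set \<Rightarrow> 'e list \<Rightarrow> 'l list \<Rightarrow> bool" where
  "coherent R es w \<longleftrightarrow> (\<forall>(e, a)\<in>set (zip es w). \<forall>(e', a')\<in>set (zip es w). a = a' \<longrightarrow> (e, e') \<in> R)"

lemma coherentD:
  "coherent R es w \<Longrightarrow> (e, a) \<in> set (zip es w) \<Longrightarrow> (e', a) \<in> set (zip es w) \<Longrightarrow> (e, e') \<in> R"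
  unfolding coherent_def by blast

lemma coherent_mono:
  "coherent R es w \<Longrightarrow> set (zip es' w') \<subseteq> set (zip es w) \<Longrightarrow> coherent R es' w'"
  unfolding coherent_def by blast

definition label_words :: "nat \<Rightarrow> nat list set" where
  "label_words k = {w. set w \<subseteq> {..<k} \<and> length w = k}"

lemma finite_label_words [simp]: "finite (label_words k)"
  unfolding label_words_def by (rule finite_lists_length_eq) simp

lemma card_label_words: "card (label_words k) = k ^ k"
  unfolding label_words_def by (subst card_lists_length_eq) auto

lemma real_card_UN_label_words_le:
  assumes "W \<subseteq> label_words k" and "\<And>w. w \<in> W \<Longrightarrow> real (card (A w)) \<le> B" and "0 \<le> B"
  shows "real (card (\<Union>w\<in>W. A w)) \<le> real k ^ k * B"
proof -
  have "finite W" and "card W \<le> k ^ k"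
    using assms(1) card_mono[OF _ assms(1)] by (auto simp: card_label_words intro: finite_subset)
  have "real (card (\<Union>w\<in>W. A w)) \<le> (\<Sum>w\<in>W. real (card (A w)))"
    unfolding of_nat_sum[symmetric] of_nat_le_iff by (rule card_UN_le[OF \<open>finite W\<close>])
  also have "\<dots> \<le> real (card W) * B"
    by (rule sum_bounded_above[OF assms(2)])
  also have "\<dots> \<le> real k ^ k * B"
    using \<open>card W \<le> k ^ k\<close> assms(3)
    by (intro mult_right_mono) (simp_all flip: of_nat_power)
  finally show ?thesis .
qed

text \<open>\<open>max_collisions\<close> is the quantity bounded in (O1) and \<open>card (turns V R)\<close> the one in (O3).\<close>

definition collisions :: "'v set \<Rightarrow> (('v \<times> 'v) \<times> 'v \<times> 'v) set \<Rightarrow> 'v \<Rightarrow> ('v \<times> 'v \<times> 'v) set" where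
  "collisions V R p = {(q, r, s). q \<in> V \<and> r \<in> V \<and> s \<in> V \<and> ((p, q), (r, s)) \<in> R}"

definition max_collisions :: "'v set \<Rightarrow> (('v \<times> 'v) \<times> 'v \<times> 'v) set \<Rightarrow> nat" where
  "max_collisions V R = Max ((\<lambda>p. card (collisions V R p)) ` V)"

definition turns :: "'v set \<Rightarrow> (('v \<times> 'v) \<times> 'v \<times> 'v) set \<Rightarrow> ('v \<times> 'v \<times> 'v) set" where
  "turns V R = {(p, q, r). p \<in> V \<and> q \<in> V \<and> r \<in> V \<and> ((p, q), (q, r)) \<in> R \<and> r \<noteq> p}"

lemma finite_collisions [simp]: "finite V \<Longrightarrow> finite (collisions V R p)"
  by (rule finite_subset[of _ "V \<times> V \<times> V"]) (auto simp: collisions_def)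

lemma card_collisions_le: "finite V \<Longrightarrow> p \<in> V \<Longrightarrow> card (collisions V R p) \<le> max_collisions V R"
  by (simp add: max_collisions_def)

lemma finite_turns [simp]: "finite V \<Longrightarrow> finite (turns V R)"
  by (rule finite_subset[of _ "V \<times> V \<times> V"]) (auto simp: turns_def)

locale edge_relation = bounded_degree_graph V adj \<Delta>
  for V :: "'v set" and adj :: "'v \<Rightarrow> 'v \<Rightarrow> bool" and \<Delta> :: nat +
  fixes R :: "(('v \<times> 'v) \<times> 'v \<times> 'v) set" and K :: nat
  assumes equiv: "equiv (V \<times> V) R"
    and reversed_edge: "p \<in> V \<Longrightarrow> q \<in> V \<Longrightarrow> ((p, q), (q, p)) \<in> R"
    and fibre_le: "p \<in> V \<Longrightarrow> q \<in> V \<Longrightarrow> r \<in> V \<Longrightarrow> card {s \<in> V. ((p, q), (r, s)) \<in> R} \<le> K"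
    and K_pos: "0 < K"
begin

lemma R_sym: "(e, e') \<in> R \<Longrightarrow> (e', e) \<in> R"
  using equiv by (meson equivE symD)

lemma R_trans: "(e, e') \<in> R \<Longrightarrow> (e', e'') \<in> R \<Longrightarrow> (e, e'') \<in> R"
  using equiv by (meson equivE transD)

lemma R_subset: "R \<subseteq> (V \<times> V) \<times> (V \<times> V)"
  using equiv_type[OF equiv] .

lemma R_swap: "(e, e') \<in> R \<Longrightarrow> (prod.swap e, prod.swap e') \<in> R"
proof -
  assume "(e, e') \<in> R"
  moreover have "(f, prod.swap f) \<in> R" if "f \<in> V \<times> V" for f
    using that reversed_edge by (cases f) auto
  moreover have "e \<in> V \<times> V" "e' \<in> V \<times> V"
    using \<open>(e, e') \<in> R\<close> R_subset by blast+
  ultimately show ?thesis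
    using R_sym R_trans by meson
qed

definition coherent_walks :: "'l list \<Rightarrow> 'v list set" where
  "coherent_walks w = {p \<in> walks (length w). coherent R (edges p) w}"

lemma finite_coherent_walks [simp]: "finite (coherent_walks w)"
  by (simp add: coherent_walks_def)

lemma coherent_walks_length: "p \<in> coherent_walks w \<Longrightarrow> length p = Suc (length w)"
  by (simp add: coherent_walks_def walks_length)

lemma coherent_walks_ConsD:
  assumes "x # p \<in> coherent_walks (a # w)"
  shows "p \<in> coherent_walks w" and "x \<in> V" and "adj x (hd p)"
    and "(e, a) \<in> set (zip (edges p) w) \<Longrightarrow> (e, (x, hd p)) \<in> R"
proof -
  have walk: "p \<in> walks (length w)" "x \<in> V" "adj x (hd p)" and "coherent R (edges (x # p)) (a # w)"
    using assms by (auto simp: coherent_walks_def walks_Cons_iff)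
  then have coherent_Cons: "coherent R ((x, hd p) # edges p) (a # w)"
    by (cases p) auto
  have "coherent R (edges p) w"
    by (rule coherent_mono[OF coherent_Cons]) auto
  with walk show "p \<in> coherent_walks w" "x \<in> V" "adj x (hd p)"
    by (simp_all add: coherent_walks_def)
  show "(e, (x, hd p)) \<in> R" if "(e, a) \<in> set (zip (edges p) w)"
    using that by (intro coherentD[OF coherent_Cons]) auto
qed

lemma coherent_walks_dropD: "p \<in> coherent_walks (u @ w) \<Longrightarrow> drop (length u) p \<in> coherent_walks w"
proof (induction u arbitrary: p)
  case (Cons c u)
  then obtain x q where p_eq: "p = x # q"
    by (cases p) (auto dest: coherent_walks_length)
  with Cons.prems have "q \<in> coherent_walks (u @ w)"
    using coherent_walks_ConsD(1) by simp
  with p_eq show ?case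
    using Cons.IH by simp
qed simp

lemma rev_coherent_walks:
  assumes p_in: "p \<in> coherent_walks w"
  shows "rev p \<in> coherent_walks (rev w)"
proof -
  have "zip (edges (rev p)) (rev w) = rev (map (\<lambda>(e, a). (prod.swap e, a)) (zip (edges p) w))"
    using coherent_walks_length[OF p_in] by (simp add: edges_rev zip_rev zip_map1)
  then have "set (zip (edges (rev p)) (rev w))
      = (\<lambda>(e, a). (prod.swap e, a)) ` set (zip (edges p) w)"
    by simp
  moreover have coherent_p: "coherent R (edges p) w"
    using p_in by (simp add: coherent_walks_def)
  ultimately have "coherent R (edges (rev p)) (rev w)"
    unfolding coherent_def using R_swap coherentD[OF coherent_p] by auto
  with p_in show ?thesis
    by (simp add: coherent_walks_def)
qed

lemma coherent_walks_takeD: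
  assumes "p \<in> coherent_walks (w @ v)"
  shows "take (Suc (length w)) p \<in> coherent_walks w"
proof -
  have "drop (length (rev v)) (rev p) \<in> coherent_walks (rev w)"
    using rev_coherent_walks[OF assms] by (intro coherent_walks_dropD) simp
  then have "rev (take (Suc (length w)) p) \<in> coherent_walks (rev w)"
    using coherent_walks_length[OF assms] by (simp add: drop_rev)
  then show ?thesis
    using rev_coherent_walks by fastforce
qed

lemma card_coherent_Cons_repeated_le:
  assumes p_in: "p \<in> coherent_walks w" and old_letter: "a \<in> set w"
  shows "card {x. x # p \<in> coherent_walks (a # w)} \<le> K"
proof -
  have walk: "p \<in> walks (length w)"
    using p_in by (simp add: coherent_walks_def)
  then have "length (edges p) = length w"
    by (simp add: walks_length)
  then obtain r s where labelled_edge: "((r, s), a) \<in> set (zip (edges p) w)"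
    using old_letter by (metis in_set_impl_in_set_zip2 surj_pair)
  have "{x. x # p \<in> coherent_walks (a # w)} \<subseteq> {x \<in> V. ((r, s), (hd p, x)) \<in> R}"
  proof
    fix x assume "x \<in> {x. x # p \<in> coherent_walks (a # w)}"
    then have "x \<in> V" "((r, s), (x, hd p)) \<in> R"
      using coherent_walks_ConsD[of x p a w] labelled_edge by auto
    then show "x \<in> {x \<in> V. ((r, s), (hd p, x)) \<in> R}"
      using R_trans reversed_edge hd_walks[OF walk] by blast
  qed
  then have "card {x. x # p \<in> coherent_walks (a # w)} \<le> card {x \<in> V. ((r, s), (hd p, x)) \<in> R}"
    by (intro card_mono) auto
  also have "\<dots> \<le> K"
    using set_edges_walks[OF walk] hd_walks[OF walk] set_zip_leftD[OF labelled_edge]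
    by (intro fibre_le) auto
  finally show ?thesis .
qed

lemma card_coherent_Cons_le:
  assumes "p \<in> coherent_walks w"
  shows "card {x. x # p \<in> coherent_walks (a # w)} \<le> \<Delta>"
proof -
  have "{x. x # p \<in> coherent_walks (a # w)} \<subseteq> neighbours (hd p)"
    using coherent_walks_ConsD(2,3) adj_commute by (auto simp: neighbours_def)
  then have "card {x. x # p \<in> coherent_walks (a # w)} \<le> card (neighbours (hd p))"
    by (intro card_mono) auto
  also have "\<dots> \<le> \<Delta>"
    using assms by (intro card_neighbours_le hd_walks) (auto simp: coherent_walks_def)
  finally show ?thesis .
qed

lemma card_coherent_extend_Cons:
  assumes "S \<subseteq> coherent_walks w"
  shows "card {p \<in> coherent_walks (a # w). tl p \<in> S} \<le> card S * (if a \<in> set w then K else \<Delta>)"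
proof -
  have finite_S: "finite S"
    using assms by (rule finite_subset) simp
  have "{p \<in> coherent_walks (a # w). tl p \<in> S} =
      (\<Union>p\<in>S. (\<lambda>x. x # p) ` {x. x # p \<in> coherent_walks (a # w)})" (is "?L = ?R")
  proof
    show "?L \<subseteq> ?R"
    proof
      fix p assume p: "p \<in> ?L"
      then obtain x q where "p = x # q"
        by (cases p) (auto dest: coherent_walks_length)
      with p show "p \<in> ?R"
        by auto
    qed
  qed auto
  also have "card \<dots> \<le> card S * (if a \<in> set w then K else \<Delta>)"
  proof (rule card_UN_le_mult[OF finite_S])
    fix p assume "p \<in> S"
    then have "p \<in> coherent_walks w"
      using assms by blast
    then show "card ((\<lambda>x. x # p) ` {x. x # p \<in> coherent_walks (a # w)})
        \<le> (if a \<in> set w then K else \<Delta>)"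
      by (simp add: card_image inj_on_def card_coherent_Cons_repeated_le card_coherent_Cons_le)
  qed
  finally show ?thesis .
qed

lemma card_coherent_extend_left:
  assumes S_subset: "S \<subseteq> coherent_walks w"
  shows "card {p \<in> coherent_walks (u @ w). drop (length u) p \<in> S}
       \<le> card S * K ^ length u * \<Delta> ^ card (set u - set w)"
proof (induction u)
  case Nil
  have "finite S"
    using S_subset by (rule finite_subset) simp
  then show ?case
    using card_mono[of S "{p \<in> coherent_walks w. p \<in> S}"] by auto
next
  case (Cons a u)
  let ?T = "{p \<in> coherent_walks (u @ w). drop (length u) p \<in> S}"
  let ?n = "card (set u - set w)"
  have "{p \<in> coherent_walks ((a # u) @ w). drop (length (a # u)) p \<in> S}
      \<subseteq> {p \<in> coherent_walks (a # u @ w). tl p \<in> ?T}"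
    using coherent_walks_dropD[of _ "[a]" "u @ w"] by (auto simp: drop_Suc)
  then have "card {p \<in> coherent_walks ((a # u) @ w). drop (length (a # u)) p \<in> S}
      \<le> card {p \<in> coherent_walks (a # u @ w). tl p \<in> ?T}"
    by (intro card_mono) auto
  also have "\<dots> \<le> card ?T * (if a \<in> set (u @ w) then K else \<Delta>)"
    by (intro card_coherent_extend_Cons) auto
  also have "\<dots> \<le> card S * K ^ length u * \<Delta> ^ ?n * (if a \<in> set (u @ w) then K else \<Delta>)"
    by (intro mult_right_mono Cons.IH) simp
  also have "\<dots> \<le> card S * K ^ length (a # u) * \<Delta> ^ card (set (a # u) - set w)"
  proof (cases "a \<in> set (u @ w)")
    case True
    then have "set (a # u) - set w = set u - set w"
      by auto
    with True show ?thesis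
      by (simp add: mult_ac)
  next
    case False
    then have "card (set (a # u) - set w) = Suc ?n"
      by (simp add: insert_Diff_if)
    with False K_pos show ?thesis
      by (simp add: mult_ac)
  qed
  finally show ?case .
qed

lemma card_coherent_extend_right:
  assumes S_subset: "S \<subseteq> coherent_walks w"
  shows "card {p \<in> coherent_walks (w @ v). take (Suc (length w)) p \<in> S}
       \<le> card S * K ^ length v * \<Delta> ^ card (set v - set w)"
proof -
  let ?L = "{p \<in> coherent_walks (w @ v). take (Suc (length w)) p \<in> S}"
  have "rev ` ?L \<subseteq> {p \<in> coherent_walks (rev v @ rev w). drop (length (rev v)) p \<in> rev ` S}"
    using rev_coherent_walks by (fastforce simp: drop_rev coherent_walks_length)
  then have "card (rev ` ?L)
      \<le> card {p \<in> coherent_walks (rev v @ rev w). drop (length (rev v)) p \<in> rev ` S}"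
    by (intro card_mono) auto
  also have "\<dots> \<le> card (rev ` S) * K ^ length (rev v) * \<Delta> ^ card (set (rev v) - set (rev w))"
    using S_subset rev_coherent_walks by (intro card_coherent_extend_left) auto
  finally show ?thesis
    by (simp add: card_image)
qed

lemma card_coherent_extend:
  assumes S_subset: "S \<subseteq> coherent_walks w"
  shows "card {p \<in> coherent_walks (u @ w @ v). take (Suc (length w)) (drop (length u) p) \<in> S}
       \<le> card S * K ^ (length u + length v) * \<Delta> ^ card (set (u @ v) - set w)"
proof -
  let ?T = "{p \<in> coherent_walks (w @ v). take (Suc (length w)) p \<in> S}"
  have "card {p \<in> coherent_walks (u @ w @ v). take (Suc (length w)) (drop (length u) p) \<in> S}
      \<le> card {p \<in> coherent_walks (u @ w @ v). drop (length u) p \<in> ?T}"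
    using coherent_walks_dropD by (intro card_mono) auto
  also have "\<dots> \<le> card ?T * (K ^ length u * \<Delta> ^ card (set u - set (w @ v)))"
    using card_coherent_extend_left[of ?T "w @ v" u] by (simp add: mult.assoc)
  also have "\<dots> \<le> card S * K ^ length v * \<Delta> ^ card (set v - set w)
      * (K ^ length u * \<Delta> ^ card (set u - set (w @ v)))"
    by (intro mult_right_mono card_coherent_extend_right S_subset) simp
  also have "\<dots> = card S * K ^ (length u + length v)
      * \<Delta> ^ (card (set u - set (w @ v)) + card (set v - set w))"
    by (simp add: power_add mult_ac)
  also have "card (set u - set (w @ v)) + card (set v - set w)
      = card ((set u - set (w @ v)) \<union> (set v - set w))"
    by (rule card_Un_disjoint[symmetric]) auto
  also have "(set u - set (w @ v)) \<union> (set v - set w) = set (u @ v) - set w"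
    by auto
  finally show ?thesis .
qed

lemma card_coherent_walks_le:
  fixes w :: "'l list"
  shows "card (coherent_walks w) \<le> card V * K ^ length w * \<Delta> ^ card (set w)"
proof -
  let ?S = "(\<lambda>x. [x]) ` V"
  have S_subset: "?S \<subseteq> coherent_walks ([] :: 'l list)"
    by (auto simp: coherent_walks_def walks_def coherent_def)
  have "coherent_walks w = {p \<in> coherent_walks w. take (Suc 0) p \<in> ?S}"
    by (auto simp: coherent_walks_def walks_def length_Suc_conv)
  also have "card \<dots> \<le> card ?S * K ^ length w * \<Delta> ^ card (set w)"
    using card_coherent_extend_right[OF S_subset, of w] by simp
  finally show ?thesis
    by (simp add: card_image inj_on_def)
qed


subsection \<open>A repeated letter that is not adjacent to itself\<close>

lemma coherent_loopE:
  assumes p_in: "p \<in> coherent_walks (a # x @ [a])" and nonempty: "x \<noteq> []"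
  obtains p\<^sub>0 ys r s where "p = p\<^sub>0 # ys @ [r, s]" "ys \<in> walks (length x - 1)" "p\<^sub>0 \<in> V"
    "(hd ys, r, s) \<in> collisions V R p\<^sub>0"
proof -
  obtain p\<^sub>0 p' where p': "p = p\<^sub>0 # p'" "length p' = length x + 2"
    using coherent_walks_length[OF p_in] by (cases p) auto
  define ys where "ys = take (length x) p'"
  have "length (drop (length x) p') = Suc (Suc 0)"
    using p' by simp
  then obtain r s where "drop (length x) p' = [r, s]"
    unfolding length_Suc_conv by auto
  then have p'_eq: "p' = ys @ [r, s]" and ys_props: "length ys = length x" "ys \<noteq> []"
    using append_take_drop_id[of "length x" p'] p'(2) nonempty by (auto simp: ys_def)
  have walk: "p \<in> walks (Suc (Suc (length x)))" and coherent_p: "coherent R (edges p) (a # x @ [a])"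
    using p_in by (auto simp: coherent_walks_def)
  have "take (Suc (length x - 1)) p' \<in> walks (length x - 1)"
    using walk unfolding p'(1)
    by (intro walks_takeI[of _ "Suc (length x)"]) (simp_all add: walks_Cons_iff)
  then have "ys \<in> walks (length x - 1)"
    using nonempty by (simp add: ys_def)
  moreover have "p\<^sub>0 \<in> V" "hd ys \<in> V" "r \<in> V" "s \<in> V"
    using walk ys_props(2) by (auto simp: walks_def p' p'_eq)
  moreover have "((p\<^sub>0, hd ys), (r, s)) \<in> R"
  proof (rule coherentD[OF coherent_p])
    have "edges p = ((p\<^sub>0, hd ys) # edges (ys @ [r])) @ [(r, s)]"
      using edges_append[of "p\<^sub>0 # ys" r "[s]"] ys_props(2) by (simp add: p' p'_eq edges_Cons)
    then have "zip (edges p) ((a # x) @ [a])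
        = zip ((p\<^sub>0, hd ys) # edges (ys @ [r])) (a # x) @ zip [(r, s)] [a]"
      using ys_props(1) by (simp only: append_Cons) (subst zip_append[symmetric], simp_all)
    then show "((p\<^sub>0, hd ys), a) \<in> set (zip (edges p) (a # x @ [a]))"
      and "((r, s), a) \<in> set (zip (edges p) (a # x @ [a]))"
      by auto
  qed
  ultimately show thesis
    using that[of p\<^sub>0 ys r s] p'(1) p'_eq by (simp add: collisions_def)
qed

text \<open>Each collision fixes both ends of the stretch \<open>x\<close>, so one of its vertices is no longer free.\<close>

lemma card_coherent_loop:
  assumes "x \<noteq> []"
  shows "card (coherent_walks (a # x @ [a])) \<le> card V * max_collisions V R * \<Delta> ^ (length x - 1)"
proof -
  let ?m = "length x - 1"
  let ?W = "\<lambda>p\<^sub>0 (q, r, s). (\<lambda>ys. p\<^sub>0 # ys @ [r, s]) ` walks_from q ?m"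
  have "card (?W p\<^sub>0 t) \<le> \<Delta> ^ ?m" for p\<^sub>0 t
    by (auto intro: order_trans[OF card_image_le card_walks_from_le] split: prod.split)
  then have "card (\<Union>t\<in>collisions V R p\<^sub>0. ?W p\<^sub>0 t) \<le> card (collisions V R p\<^sub>0) * \<Delta> ^ ?m" for p\<^sub>0
    by (intro card_UN_le_mult) simp_all
  then have "card (\<Union>t\<in>collisions V R p\<^sub>0. ?W p\<^sub>0 t) \<le> max_collisions V R * \<Delta> ^ ?m"
    if "p\<^sub>0 \<in> V" for p\<^sub>0
    using mult_right_mono[OF card_collisions_le[OF finite_V that]] order_trans zero_le by blast
  then have "card (\<Union>p\<^sub>0\<in>V. \<Union>t\<in>collisions V R p\<^sub>0. ?W p\<^sub>0 t)
      \<le> card V * (max_collisions V R * \<Delta> ^ ?m)"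
    by (intro card_UN_le_mult) simp_all
  moreover have "coherent_walks (a # x @ [a]) \<subseteq> (\<Union>p\<^sub>0\<in>V. \<Union>t\<in>collisions V R p\<^sub>0. ?W p\<^sub>0 t)"
    using assms by (fastforce elim: coherent_loopE simp: walks_from_def)
  then have "card (coherent_walks (a # x @ [a])) \<le> card (\<Union>p\<^sub>0\<in>V. \<Union>t\<in>collisions V R p\<^sub>0. ?W p\<^sub>0 t)"
    by (intro card_mono) (auto split: prod.split)
  ultimately show ?thesis
    by (simp add: mult.assoc)
qed

lemma card_coherent_walks_loop_le:
  assumes innermost: "x \<noteq> []" "distinct (a # x)" and w_decomp: "w = u @ a # x @ a # v"
  shows "\<Delta>\<^sup>2 * card (coherent_walks w)
    \<le> K ^ length w * \<Delta> ^ card (set w) * (card V * max_collisions V R)"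
proof -
  let ?y = "a # x @ [a]"
  let ?r = "card (set (u @ v) - set ?y)"
  have w_eq: "w = u @ ?y @ v"
    using w_decomp by simp
  have card_w: "card (set w) = ?r + (length x - 1) + 2"
  proof -
    have "set w = (set (u @ v) - set ?y) \<union> set (a # x)"
      unfolding w_eq by auto
    also have "card \<dots> = ?r + card (set (a # x))"
      by (rule card_Un_disjoint) auto
    also have "card (set (a # x)) = (length x - 1) + 2"
      using distinct_card[OF innermost(2)] innermost(1) by (cases x) auto
    finally show ?thesis
      by simp
  qed
  have "coherent_walks w \<subseteq> {p \<in> coherent_walks (u @ ?y @ v).
      take (Suc (length ?y)) (drop (length u) p) \<in> coherent_walks ?y}"
    using coherent_walks_takeD coherent_walks_dropD unfolding w_eq by blast
  then have "card (coherent_walks w) \<le> card {p \<in> coherent_walks (u @ ?y @ v).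
      take (Suc (length ?y)) (drop (length u) p) \<in> coherent_walks ?y}"
    by (intro card_mono) auto
  also have "\<dots> \<le> card (coherent_walks ?y) * (K ^ (length u + length v) * \<Delta> ^ ?r)"
    using card_coherent_extend[of "coherent_walks ?y" ?y u v] by (simp add: mult.assoc)
  also have "\<dots> \<le> (card V * max_collisions V R * \<Delta> ^ (length x - 1)) * (K ^ length w * \<Delta> ^ ?r)"
    using K_pos unfolding w_eq
    by (intro mult_mono card_coherent_loop innermost(1) mult_right_mono power_increasing) auto
  finally have "\<Delta>\<^sup>2 * card (coherent_walks w) \<le>
      \<Delta>\<^sup>2 * ((card V * max_collisions V R * \<Delta> ^ (length x - 1)) * (K ^ length w * \<Delta> ^ ?r))"
    by (rule mult_left_mono) simp
  also have "\<dots> = K ^ length w * \<Delta> ^ (?r + (length x - 1) + 2) * (card V * max_collisions V R)"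
    by (simp only: power_add mult_ac)
  finally show ?thesis
    unfolding card_w .
qed


subsection \<open>A letter adjacent to itself\<close>

lemma card_coherent_turning_walks:
  "card {p \<in> coherent_walks (u @ a # a # v). p ! length u \<noteq> p ! (length u + 2)}
     \<le> card (turns V R) * K ^ (length u + length v) * \<Delta> ^ card (set (u @ v) - {a})"
    (is "card ?L \<le> _")
proof -
  let ?S = "{p \<in> coherent_walks [a, a]. p ! 0 \<noteq> p ! 2}"
  let ?K = "K ^ (length u + length v)" and ?n = "card (set (u @ v) - set [a, a])"
  have "?L \<subseteq> {p \<in> coherent_walks (u @ [a, a] @ v).
      take (Suc (length [a, a])) (drop (length u) p) \<in> ?S}"
  proof
    fix p assume p: "p \<in> ?L"
    then have "take (Suc (length [a, a])) (drop (length u) p) \<in> coherent_walks [a, a]"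
      using coherent_walks_dropD[of p u "[a, a] @ v"] by (intro coherent_walks_takeD) simp
    with p show "p \<in> {p \<in> coherent_walks (u @ [a, a] @ v).
        take (Suc (length [a, a])) (drop (length u) p) \<in> ?S}"
      by (auto simp: coherent_walks_length)
  qed
  then have "card ?L \<le> card {p \<in> coherent_walks (u @ [a, a] @ v).
      take (Suc (length [a, a])) (drop (length u) p) \<in> ?S}"
    by (intro card_mono) auto
  also have "\<dots> \<le> card ?S * (?K * \<Delta> ^ ?n)"
    using card_coherent_extend[of ?S "[a, a]" u v] by (simp add: mult.assoc)
  also have "\<dots> \<le> card (turns V R) * (?K * \<Delta> ^ ?n)"
  proof (rule mult_right_mono)
    have "?S \<subseteq> (\<lambda>(p, q, r). [p, q, r]) ` turns V R"
    proof
      fix p assume p: "p \<in> ?S"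
      then obtain x y z where xyz: "p = [x, y, z]"
        using coherent_walks_length[of p "[a, a]"] by (auto simp: length_Suc_conv)
      have "((x, y), (y, z)) \<in> R"
        using p coherentD[of R "edges p" "[a, a]" "(x, y)" a "(y, z)"]
        by (simp add: coherent_walks_def xyz)
      with p have "(x, y, z) \<in> turns V R"
        by (auto simp: turns_def coherent_walks_def walks_def xyz)
      then show "p \<in> (\<lambda>(p, q, r). [p, q, r]) ` turns V R"
        unfolding xyz by (rule rev_image_eqI) simp
    qed
    then show "card ?S \<le> card (turns V R)"
      by (rule surj_card_le[rotated]) simp
  qed simp
  finally show ?thesis
    by (simp add: mult.assoc)
qed

definition noncontour_walks :: "'l list \<Rightarrow> 'v list set" where
  "noncontour_walks w = {p \<in> coherent_walks w. \<nexists>d. contour [] d p}"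

lemma finite_noncontour_walks [simp]: "finite (noncontour_walks w)"
  by (simp add: noncontour_walks_def)

lemma noncontour_walks_Nil: "noncontour_walks [] = {}"
proof -
  have "contour [] [] p" if "p \<in> coherent_walks []" for p
    using coherent_walks_length[OF that] by (auto simp: length_Suc_conv)
  then show ?thesis
    by (auto simp: noncontour_walks_def)
qed

lemma noncontour_walks_contract:
  assumes "p @ x # y # x # q \<in> noncontour_walks (u @ a # a # v)" and "length p = length u"
  shows "p @ x # q \<in> noncontour_walks (u @ v)" and "y \<in> neighbours x"
proof -
  have walk: "p @ x # y # x # q \<in> walks (length (u @ a # a # v))"
    and coherent_p: "coherent R (edges (p @ x # y # x # q)) (u @ a # a # v)"
    using assms(1) by (auto simp: noncontour_walks_def coherent_walks_def)
  have length_edges_p: "length (edges (p @ [x])) = length u"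
    using assms(2) by simp
  have "coherent R (edges (p @ x # q)) (u @ v)"
    by (rule coherent_mono[OF coherent_p])
      (auto simp: edges_append[of p x q] edges_append[of p x "y # x # q"]
        zip_append[OF length_edges_p])
  moreover have "p @ x # q \<in> walks (length (u @ v))"
    using walk by (auto simp: walks_def successively_append_iff successively_Cons)
  moreover have "\<not> contour [] d (p @ x # q)" for d
    using assms(1) contour_insert_backtrack[of "[]" d p x q y] by (auto simp: noncontour_walks_def)
  ultimately show "p @ x # q \<in> noncontour_walks (u @ v)"
    by (simp add: noncontour_walks_def coherent_walks_def)
  show "y \<in> neighbours x"
    using walk by (auto simp: walks_def successively_append_iff neighbours_def)
qed

lemma noncontour_walks_backtrackE:
  assumes p_in: "p \<in> noncontour_walks (u @ a # a # v)"
    and returns: "p ! length u = p ! (length u + 2)"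
  obtains q y where "q \<in> noncontour_walks (u @ v)" "y \<in> neighbours (q ! length u)"
    "p = take (Suc (length u)) q @ y # drop (length u) q"
proof -
  define p\<^sub>1 where "p\<^sub>1 = take (length u) p"
  have length_p: "length p = length u + length v + 3"
    using p_in coherent_walks_length by (fastforce simp: noncontour_walks_def)
  then have len_p\<^sub>1: "length p\<^sub>1 = length u"
    by (simp add: p\<^sub>1_def)
  have "length (drop (length u) p) = Suc (Suc (Suc (length v)))"
    using length_p by simp
  then obtain x y z p\<^sub>2 where "drop (length u) p = x # y # z # p\<^sub>2"
    unfolding length_Suc_conv by auto
  then have p_eq: "p = p\<^sub>1 @ x # y # z # p\<^sub>2"
    using append_take_drop_id[of "length u" p] by (simp add: p\<^sub>1_def)
  have "z = x"
    using returns len_p\<^sub>1 unfolding p_eq by (simp add: nth_append)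
  then have "p\<^sub>1 @ x # p\<^sub>2 \<in> noncontour_walks (u @ v)" "y \<in> neighbours x"
    using noncontour_walks_contract[of p\<^sub>1 x y p\<^sub>2 u a v] p_in len_p\<^sub>1 p_eq by simp_all
  then show thesis
    using that[of "p\<^sub>1 @ x # p\<^sub>2" y] p_eq \<open>z = x\<close> len_p\<^sub>1 by (simp add: nth_append)
qed

lemma card_noncontour_walks_backtrack:
  "card (noncontour_walks (u @ a # a # v))
     \<le> card (turns V R) * K ^ (length u + length v) * \<Delta> ^ card (set (u @ v) - {a})
       + card (noncontour_walks (u @ v)) * \<Delta>"
proof -
  let ?turning = "{p \<in> coherent_walks (u @ a # a # v). p ! length u \<noteq> p ! (length u + 2)}"
  let ?insert = "\<lambda>q. (\<lambda>y. take (Suc (length u)) q @ y # drop (length u) q)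
    ` neighbours (q ! length u)"
  let ?back = "\<Union>q\<in>noncontour_walks (u @ v). ?insert q"
  have "noncontour_walks (u @ a # a # v) \<subseteq> ?turning \<union> ?back"
  proof
    fix p assume p: "p \<in> noncontour_walks (u @ a # a # v)"
    show "p \<in> ?turning \<union> ?back"
    proof (cases "p ! length u = p ! (length u + 2)")
      case True
      with p show ?thesis
        by (elim noncontour_walks_backtrackE) auto
    next
      case False
      with p show ?thesis
        by (simp add: noncontour_walks_def)
    qed
  qed
  then have "card (noncontour_walks (u @ a # a # v)) \<le> card (?turning \<union> ?back)"
    by (intro card_mono) auto
  also have "\<dots> \<le> card ?turning + card ?back"
    by (rule card_Un_le)
  also have "card ?back \<le> card (noncontour_walks (u @ v)) * \<Delta>"
  proof (rule card_UN_le_mult)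
    fix q assume "q \<in> noncontour_walks (u @ v)"
    then have "q ! length u \<in> V"
      using coherent_walks_length[of q "u @ v"] nth_mem[of "length u" q]
      by (auto simp: noncontour_walks_def coherent_walks_def walks_def)
    then show "card (?insert q) \<le> \<Delta>"
      by (intro order_trans[OF card_image_le card_neighbours_le]) simp_all
  qed simp
  finally show ?thesis
    using card_coherent_turning_walks[of u a v] by linarith
qed

definition pairing_defect :: nat where
  "pairing_defect = \<Delta> * card (turns V R) + card V * max_collisions V R"

lemma card_noncontour_walks_insert_pair:
  assumes new_letter: "a \<notin> set (u @ v)" and bound: "\<Delta>\<^sup>2 * card (noncontour_walks (u @ v))
      \<le> card (set (u @ v)) * (K ^ length (u @ v) * \<Delta> ^ card (set (u @ v)) * pairing_defect)"
  shows "\<Delta>\<^sup>2 * card (noncontour_walks (u @ a # a # v))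
      \<le> Suc (card (set (u @ v)))
        * (K ^ length (u @ a # a # v) * \<Delta> ^ Suc (card (set (u @ v))) * pairing_defect)"
proof -
  let ?n = "card (set (u @ v))"
  let ?P = "K ^ length (u @ v)"
  let ?D = pairing_defect
  have "\<Delta>\<^sup>2 * card (noncontour_walks (u @ a # a # v))
      \<le> \<Delta>\<^sup>2 * (card (turns V R) * ?P * \<Delta> ^ ?n + card (noncontour_walks (u @ v)) * \<Delta>)"
    using card_noncontour_walks_backtrack[of u a v] Diff_insert0[OF new_letter, of "{}"]
    by (intro mult_left_mono) simp_all
  also have "\<dots> = ?P * \<Delta> ^ Suc ?n * (\<Delta> * card (turns V R))
      + \<Delta> * (\<Delta>\<^sup>2 * card (noncontour_walks (u @ v)))"
    by (simp add: algebra_simps power2_eq_square)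
  also have "\<dots> \<le> ?P * \<Delta> ^ Suc ?n * ?D + \<Delta> * (?n * (?P * \<Delta> ^ ?n * ?D))"
    by (intro add_mono mult_left_mono bound) (simp_all add: pairing_defect_def)
  also have "\<dots> = Suc ?n * (?P * \<Delta> ^ Suc ?n * ?D)"
    by (simp add: algebra_simps)
  also have "\<dots> \<le> Suc ?n * (K ^ length (u @ a # a # v) * \<Delta> ^ Suc ?n * ?D)"
    using K_pos by (intro mult_left_mono mult_right_mono power_increasing) auto
  finally show ?thesis .
qed

lemma card_noncontour_walks_loop_le:
  assumes innermost: "x \<noteq> []" "distinct (a # x)" and w_decomp: "w = u @ a # x @ a # v"
  shows "\<Delta>\<^sup>2 * card (noncontour_walks w)
    \<le> card (set w) * (K ^ length w * \<Delta> ^ card (set w) * pairing_defect)"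
proof -
  have "card (noncontour_walks w) \<le> card (coherent_walks w)"
    by (intro card_mono) (auto simp: noncontour_walks_def)
  then have "\<Delta>\<^sup>2 * card (noncontour_walks w) \<le> \<Delta>\<^sup>2 * card (coherent_walks w)"
    by simp
  also have "\<dots> \<le> K ^ length w * \<Delta> ^ card (set w) * (card V * max_collisions V R)"
    by (rule card_coherent_walks_loop_le[OF assms])
  also have "\<dots> \<le> 1 * (K ^ length w * \<Delta> ^ card (set w) * pairing_defect)"
    by (simp add: pairing_defect_def)
  also have "\<dots> \<le> card (set w) * (K ^ length w * \<Delta> ^ card (set w) * pairing_defect)"
    using w_decomp by (intro mult_right_mono) (simp_all add: Suc_le_eq card_gt_0_iff)
  finally show ?thesis .
qed

lemma card_noncontour_walks_le:
  "pair_word w \<Longrightarrow>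
     \<Delta>\<^sup>2 * card (noncontour_walks w)
       \<le> card (set w) * (K ^ length w * \<Delta> ^ card (set w) * pairing_defect)"
proof (induction "length w" arbitrary: w rule: less_induct)
  case less
  show ?case
  proof (cases "w = []")
    case True
    then show ?thesis
      by (simp add: noncontour_walks_Nil)
  next
    case False
    then obtain u a x v where w_decomp: "w = u @ a # x @ a # v" and innermost: "distinct (a # x)"
      using pair_word_distinct_iff[OF less.prems] not_distinct_decomp_innermost by blast
    show ?thesis
    proof (cases "x = []")
      case True
      with w_decomp have w_eq: "w = u @ a # a # v"
        by simp
      note remove = pair_word_remove_pair[OF less.prems[unfolded w_eq]]
      have "card (set w) = Suc (card (set (u @ v)))"
        using remove(1) by (simp add: w_eq)
      moreover have "length (u @ v) < length w"
        by (simp add: w_eq)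
      ultimately show ?thesis
        using card_noncontour_walks_insert_pair[OF remove(1) less.hyps[OF _ remove(2)]] w_eq by simp
    next
      case False
      then show ?thesis
        using card_noncontour_walks_loop_le[OF _ innermost w_decomp] by blast
    qed
  qed
qed


subsection \<open>Exceptional walks\<close>

definition degenerate_walks :: "nat \<Rightarrow> 'v list set" where
  "degenerate_walks k = (\<Union>w\<in>{w \<in> label_words k. 2 * card (set w) < k}. coherent_walks w)"

definition crossing_walks :: "nat \<Rightarrow> 'v list set" where
  "crossing_walks k = (\<Union>w\<in>{w \<in> label_words k. pair_word w}. noncontour_walks w)"

definition exceptional_walks :: "nat \<Rightarrow> 'v list set" where
  "exceptional_walks k = degenerate_walks k \<union> crossing_walks k"

lemma finite_exceptional_walks [simp]: "finite (exceptional_walks k)"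
  by (simp add: exceptional_walks_def degenerate_walks_def crossing_walks_def)

lemma card_degenerate_walks_le:
  "real (card (degenerate_walks k))
     \<le> real k ^ k * (real (card V) * real K ^ k * (sqrt (real \<Delta>) ^ k / sqrt (real \<Delta>)))"
  unfolding degenerate_walks_def
proof (rule real_card_UN_label_words_le)
  fix w assume "w \<in> {w \<in> label_words k. 2 * card (set w) < k}"
  then have few_letters: "length w = k" "2 * card (set w) < k"
    by (auto simp: label_words_def)
  let ?s = "sqrt (real \<Delta>)"
  have s_ge_1: "1 \<le> ?s"
    using \<Delta>_pos by simp
  have "real (card (coherent_walks w)) \<le> real (card V * K ^ length w * \<Delta> ^ card (set w))"
    using card_coherent_walks_le of_nat_le_iff by blast
  also have "\<dots> = real (card V) * real K ^ k * ?s ^ (2 * card (set w))"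
    using few_letters(1) by (simp add: power_mult)
  also have "\<dots> \<le> real (card V) * real K ^ k * (?s ^ k / ?s)"
  proof (rule mult_left_mono)
    have "?s ^ Suc (2 * card (set w)) \<le> ?s ^ k"
      using few_letters(2) s_ge_1 by (intro power_increasing) simp_all
    then show "?s ^ (2 * card (set w)) \<le> ?s ^ k / ?s"
      using s_ge_1 by (simp add: field_simps)
  qed simp
  finally show "real (card (coherent_walks w)) \<le> real (card V) * real K ^ k * (?s ^ k / ?s)" .
qed auto

lemma card_crossing_walks_le:
  "real (card (crossing_walks k))
     \<le> real k ^ k * (real k * real K ^ k * sqrt (real \<Delta>) ^ k * (real pairing_defect / (real \<Delta>)\<^sup>2))"
  unfolding crossing_walks_def
proof (rule real_card_UN_label_words_le)
  fix w assume w_in: "w \<in> {w \<in> label_words k. pair_word w}"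
  then have length_w: "length w = k" "k = 2 * card (set w)"
    using pair_word_length[of w] by (auto simp: label_words_def)
  have "real (\<Delta>\<^sup>2 * card (noncontour_walks w))
      \<le> real (card (set w) * (K ^ length w * \<Delta> ^ card (set w) * pairing_defect))"
    using card_noncontour_walks_le w_in of_nat_le_iff by blast
  then have "(real \<Delta>)\<^sup>2 * real (card (noncontour_walks w))
      \<le> real (card (set w)) * (real K ^ k * real \<Delta> ^ card (set w) * real pairing_defect)"
    by (simp add: length_w(1))
  also have "real \<Delta> ^ card (set w) = sqrt (real \<Delta>) ^ k"
    by (subst length_w(2)) (simp add: power_mult)
  also have "real (card (set w)) * (real K ^ k * sqrt (real \<Delta>) ^ k * real pairing_defect)
      \<le> real k * (real K ^ k * sqrt (real \<Delta>) ^ k * real pairing_defect)"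
    using length_w(2) by (intro mult_right_mono) simp_all
  finally show "real (card (noncontour_walks w))
      \<le> real k * real K ^ k * sqrt (real \<Delta>) ^ k * (real pairing_defect / (real \<Delta>)\<^sup>2)"
    using \<Delta>_pos by (simp add: field_simps)
qed auto

definition exceptional_rate :: "nat \<Rightarrow> real" where
  "exceptional_rate k = (real k * real K) ^ k * (1 / sqrt (real \<Delta>) + real k *
     (real (card (turns V R)) / (real (card V) * real \<Delta>)
        + real (max_collisions V R) / (real \<Delta>)\<^sup>2))"

lemma card_exceptional_walks_fraction_le:
  assumes "V \<noteq> {}"
  shows "real (card (exceptional_walks k)) / (real (card V) * sqrt (real \<Delta>) ^ k)
    \<le> exceptional_rate k"
proof -
  let ?n = "real (card V)" and ?s = "sqrt (real \<Delta>)"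
  have positive: "0 < ?n" "0 < ?s" "0 < real \<Delta>"
    using assms \<Delta>_pos by (simp_all add: card_gt_0_iff)
  have "real (card (exceptional_walks k))
      \<le> real (card (degenerate_walks k)) + real (card (crossing_walks k))"
    unfolding exceptional_walks_def of_nat_add[symmetric] of_nat_le_iff by (rule card_Un_le)
  also have "\<dots> \<le> real k ^ k * (?n * real K ^ k * (?s ^ k / ?s))
      + real k ^ k * (real k * real K ^ k * ?s ^ k * (real pairing_defect / (real \<Delta>)\<^sup>2))"
    by (intro add_mono card_degenerate_walks_le card_crossing_walks_le)
  also have "\<dots> = ((real k * real K) ^ k
      * (1 / ?s + real k * (real pairing_defect / (?n * (real \<Delta>)\<^sup>2)))) * (?n * ?s ^ k)"
    using positive assms by (simp add: field_simps power_mult_distrib)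
  finally have "real (card (exceptional_walks k)) / (?n * ?s ^ k)
      \<le> (real k * real K) ^ k * (1 / ?s + real k * (real pairing_defect / (?n * (real \<Delta>)\<^sup>2)))"
    using positive by (simp add: pos_divide_le_eq)
  also have "real pairing_defect / (?n * (real \<Delta>)\<^sup>2)
      = real (card (turns V R)) / (?n * real \<Delta>) + real (max_collisions V R) / (real \<Delta>)\<^sup>2"
    using positive assms by (simp add: pairing_defect_def add_divide_distrib power2_eq_square)
  finally show ?thesis
    unfolding exceptional_rate_def .
qed

end


section \<open>Expectations along a walk\<close>

lemma abs_prod_list_le_power:
  fixes xs :: "real list"
  shows "(\<And>x. x \<in> set xs \<Longrightarrow> \<bar>x\<bar> \<le> m) \<Longrightarrow> \<bar>prod_list xs\<bar> \<le> m ^ length xs"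
proof (induction xs)
  case (Cons x xs)
  have "\<bar>x\<bar> * \<bar>prod_list xs\<bar> \<le> m * m ^ length xs"
    using Cons.prems[of x] by (intro mult_mono Cons.IH Cons.prems) auto
  then show ?case
    by (simp add: abs_mult)
qed simp

lemma abs_prod_list_le_sum_powers:
  fixes xs :: "real list"
  shows "\<bar>prod_list xs\<bar> \<le> 1 + (\<Sum>x\<leftarrow>xs. \<bar>x\<bar> ^ length xs)"
proof (cases "xs = []")
  case False
  define m where "m = Max (abs ` set xs)"
  have "m \<in> abs ` set xs"
    unfolding m_def using False by (intro Max_in) auto
  then obtain x where maximal: "x \<in> set xs" "m = \<bar>x\<bar>"
    by auto
  have "\<bar>prod_list xs\<bar> \<le> m ^ length xs"
    by (rule abs_prod_list_le_power) (auto simp: m_def)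
  also have "\<dots> \<le> (\<Sum>x\<leftarrow>xs. \<bar>x\<bar> ^ length xs)"
    by (rule member_le_sum_list) (use maximal in auto)
  finally show ?thesis
    by simp
qed simp

lemma prod_list_map_partition:
  fixes f :: "'e \<Rightarrow> 'c :: comm_monoid_mult"
  assumes "finite Q"
  shows "g ` set es \<subseteq> Q \<Longrightarrow>
    prod_list (map f es) = (\<Prod>c\<in>Q. prod_list (map f (filter (\<lambda>e. g e = c) es)))"
proof (induction es)
  case (Cons e es)
  have "(\<Prod>c\<in>Q. prod_list (map f (filter (\<lambda>e. g e = c) (e # es))))
      = (\<Prod>c\<in>Q. (if g e = c then f e else 1) * prod_list (map f (filter (\<lambda>e. g e = c) es)))"
    by (intro prod.cong) auto
  also have "\<dots> = f e * prod_list (map f es)"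
    using Cons assms by (simp add: prod.distrib)
  finally show ?case
    by simp
qed simp

lemma measurable_prod_list_PiM:
  fixes es :: "'i list"
  shows "set es \<subseteq> I \<Longrightarrow>
    (\<lambda>y. prod_list (map y es)) \<in> borel_measurable (PiM I (\<lambda>_. borel :: real measure))"
proof (induction es)
  case (Cons e es)
  then have "(\<lambda>y. y e) \<in> borel_measurable (PiM I (\<lambda>_. borel :: real measure))"
    by (intro measurable_component_singleton) simp
  with Cons show ?case
    by simp
qed simp

definition undirected :: "'v \<times> 'v \<Rightarrow> 'v set" where
  "undirected e = {fst e, snd e}"

lemma undirected_commute: "undirected (x, y) = undirected (y, x)"
  by (auto simp: undirected_def)

lemma undirected_eq_iff: "undirected e = undirected e' \<longleftrightarrow> e' = e \<or> e' = prod.swap e"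
  by (cases e; cases e') (auto simp: undirected_def doubleton_eq_iff)

locale edge_ensemble = edge_relation V adj \<Delta> R K + prob_space M
  for V :: "'v set" and adj \<Delta> R K and M :: "'a measure" +
  fixes X :: "'v \<Rightarrow> 'v \<Rightarrow> 'a \<Rightarrow> real"
  assumes X_measurable: "i \<in> V \<Longrightarrow> j \<in> V \<Longrightarrow> X i j \<in> borel_measurable M"
    and X_commute: "i \<in> V \<Longrightarrow> j \<in> V \<Longrightarrow> X i j = X j i"
    and X_mean: "i \<in> V \<Longrightarrow> j \<in> V \<Longrightarrow> expectation (X i j) = 0"
    and X_variance: "i \<in> V \<Longrightarrow> j \<in> V \<Longrightarrow> expectation (\<lambda>\<omega>. (X i j \<omega>)\<^sup>2) = 1"
    and X_power_integrable: "i \<in> V \<Longrightarrow> j \<in> V \<Longrightarrow> integrable M (\<lambda>\<omega>. \<bar>X i j \<omega>\<bar> ^ m)"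
    and X_indep: "indep_vars (\<lambda>C. PiM C (\<lambda>_. borel)) (\<lambda>C \<omega>. restrict (\<lambda>(p, q). X p q \<omega>) C)
                    ((V \<times> V) // R)"
begin

definition edge_prod :: "('v \<times> 'v) list \<Rightarrow> 'a \<Rightarrow> real" where
  "edge_prod es \<omega> = prod_list (map (\<lambda>(i, j). X i j \<omega>) es)"

lemma edge_prod_Nil: "edge_prod [] = (\<lambda>\<omega>. 1)"
  by (simp add: edge_prod_def fun_eq_iff)

lemma edge_prod_Cons: "edge_prod ((i, j) # es) = (\<lambda>\<omega>. X i j \<omega> * edge_prod es \<omega>)"
  by (simp add: edge_prod_def fun_eq_iff)

lemma edge_prod_measurable [measurable]:
  "set es \<subseteq> V \<times> V \<Longrightarrow> edge_prod es \<in> borel_measurable M"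
proof (induction es)
  case (Cons e es)
  then show ?case
    using X_measurable by (cases e) (auto simp: edge_prod_Cons)
qed (simp add: edge_prod_Nil)

lemma abs_edge_prod_le: "\<bar>edge_prod es \<omega>\<bar> \<le> 1 + (\<Sum>(i, j)\<leftarrow>es. \<bar>X i j \<omega>\<bar> ^ length es)"
  using abs_prod_list_le_sum_powers[of "map (\<lambda>(i, j). X i j \<omega>) es"]
  by (simp add: edge_prod_def comp_def case_prod_unfold)

lemma integrable_sum_powers:
  "set es \<subseteq> V \<times> V \<Longrightarrow> integrable M (\<lambda>\<omega>. \<Sum>(i, j)\<leftarrow>es. \<bar>X i j \<omega>\<bar> ^ m)"
proof (induction es)
  case (Cons e es)
  then show ?case
    using X_power_integrable by (cases e) auto
qed simp

lemma expectation_sum_powers_le: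
  assumes "\<And>i j. i \<in> V \<Longrightarrow> j \<in> V \<Longrightarrow> expectation (\<lambda>\<omega>. \<bar>X i j \<omega>\<bar> ^ m) \<le> C"
  shows "set es \<subseteq> V \<times> V \<Longrightarrow>
    expectation (\<lambda>\<omega>. \<Sum>(i, j)\<leftarrow>es. \<bar>X i j \<omega>\<bar> ^ m) \<le> real (length es) * C"
proof (induction es)
  case (Cons e es)
  obtain i j where e_eq: "e = (i, j)" "i \<in> V" "j \<in> V"
    using Cons.prems by auto
  have "expectation (\<lambda>\<omega>. \<Sum>(i, j)\<leftarrow>e # es. \<bar>X i j \<omega>\<bar> ^ m)
      = expectation (\<lambda>\<omega>. \<bar>X i j \<omega>\<bar> ^ m) + expectation (\<lambda>\<omega>. \<Sum>(i, j)\<leftarrow>es. \<bar>X i j \<omega>\<bar> ^ m)"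
    using Cons.prems X_power_integrable[OF e_eq(2,3)] integrable_sum_powers[of es]
    by (simp add: e_eq(1))
  also have "\<dots> \<le> C + real (length es) * C"
    using Cons assms[OF e_eq(2,3)] by (intro add_mono) auto
  finally show ?case
    by (simp add: algebra_simps)
qed simp

lemma integrable_edge_prod:
  assumes "set es \<subseteq> V \<times> V"
  shows "integrable M (edge_prod es)"
proof (rule Bochner_Integration.integrable_bound)
  show "integrable M (\<lambda>\<omega>. 1 + (\<Sum>(i, j)\<leftarrow>es. \<bar>X i j \<omega>\<bar> ^ length es))"
    using integrable_sum_powers[OF assms] by simp
  show "AE \<omega> in M. norm (edge_prod es \<omega>) \<le> norm (1 + (\<Sum>(i, j)\<leftarrow>es. \<bar>X i j \<omega>\<bar> ^ length es))"
    by (intro AE_I2) (use abs_edge_prod_le in \<open>auto intro: order_trans[OF _ abs_ge_self]\<close>)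
qed (use assms in measurable)

lemma abs_expectation_edge_prod_le:
  assumes "\<And>i j. i \<in> V \<Longrightarrow> j \<in> V \<Longrightarrow> expectation (\<lambda>\<omega>. \<bar>X i j \<omega>\<bar> ^ length es) \<le> C"
    and es_subset: "set es \<subseteq> V \<times> V"
  shows "\<bar>expectation (edge_prod es)\<bar> \<le> 1 + real (length es) * C"
proof -
  have "\<bar>expectation (edge_prod es)\<bar> \<le> expectation (\<lambda>\<omega>. \<bar>edge_prod es \<omega>\<bar>)"
    using integral_abs_bound by blast
  also have "\<dots> \<le> expectation (\<lambda>\<omega>. 1 + (\<Sum>(i, j)\<leftarrow>es. \<bar>X i j \<omega>\<bar> ^ length es))"
    using abs_edge_prod_le integrable_edge_prod[OF es_subset] integrable_sum_powers[OF es_subset]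
    by (intro integral_mono) auto
  also have "\<dots> = 1 + expectation (\<lambda>\<omega>. \<Sum>(i, j)\<leftarrow>es. \<bar>X i j \<omega>\<bar> ^ length es)"
    using integrable_sum_powers[OF es_subset] by (simp add: prob_space)
  also have "\<dots> \<le> 1 + real (length es) * C"
    using expectation_sum_powers_le[OF assms(1) es_subset] by simp
  finally show ?thesis .
qed


subsection \<open>Factorisation over the classes\<close>

definition class_of :: "'v \<times> 'v \<Rightarrow> ('v \<times> 'v) set" where
  "class_of e = R `` {e}"

definition class_edges :: "('v \<times> 'v) set \<Rightarrow> ('v \<times> 'v) list \<Rightarrow> ('v \<times> 'v) list" where
  "class_edges c es = filter (\<lambda>e. class_of e = c) es"

lemma finite_classes: "finite ((V \<times> V) // R)"
  by (intro finite_quotient R_subset) simp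

lemma class_of_in_classes: "e \<in> V \<times> V \<Longrightarrow> class_of e \<in> (V \<times> V) // R"
  unfolding class_of_def by (rule quotientI)

lemma class_of_eq_iff: "e \<in> V \<times> V \<Longrightarrow> e' \<in> V \<times> V \<Longrightarrow> class_of e = class_of e' \<longleftrightarrow> (e, e') \<in> R"
  unfolding class_of_def using eq_equiv_class_iff[OF equiv] by blast

lemma class_of_commute: "class_of (x, y) = class_of (y, x)"
proof (cases "x \<in> V \<and> y \<in> V")
  case True
  then show ?thesis
    using reversed_edge by (simp add: class_of_eq_iff)
next
  case False
  then show ?thesis
    using R_subset by (auto simp: class_of_def)
qed

lemma class_of_swap: "class_of (prod.swap e) = class_of e"
  by (cases e) (simp add: class_of_commute)

lemma set_class_edges: "set (class_edges c es) = {e \<in> set es. class_of e = c}"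
  by (simp add: class_edges_def)

lemma set_class_edges_subset: "set es \<subseteq> V \<times> V \<Longrightarrow> set (class_edges c es) \<subseteq> c"
  using equiv_class_self[OF equiv] by (auto simp: class_of_def set_class_edges)

lemma length_class_edges: "length (class_edges c es) = count_list (map class_of es) c"
  by (simp add: class_edges_def count_list_map)

lemma indep_vars_edge_prod_classes:
  assumes "set es \<subseteq> V \<times> V"
  shows "indep_vars (\<lambda>_. borel) (\<lambda>c. edge_prod (class_edges c es)) ((V \<times> V) // R)"
proof -
  have "indep_vars (\<lambda>_. borel)
      (\<lambda>c \<omega>. prod_list (map (restrict (\<lambda>(p, q). X p q \<omega>) c) (class_edges c es))) ((V \<times> V) // R)"
    by (rule indep_vars_compose2[OF X_indep])
      (rule measurable_prod_list_PiM[OF set_class_edges_subset[OF assms]])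
  also have "(\<lambda>c \<omega>. prod_list (map (restrict (\<lambda>(p, q). X p q \<omega>) c) (class_edges c es)))
      = (\<lambda>c. edge_prod (class_edges c es))"
  proof (intro ext)
    fix c \<omega>
    have "map (restrict (\<lambda>(p, q). X p q \<omega>) c) (class_edges c es)
        = map (\<lambda>(p, q). X p q \<omega>) (class_edges c es)"
      using set_class_edges_subset[OF assms] by (intro map_cong) auto
    then show "prod_list (map (restrict (\<lambda>(p, q). X p q \<omega>) c) (class_edges c es))
        = edge_prod (class_edges c es) \<omega>"
      by (simp only: edge_prod_def)
  qed
  finally show ?thesis .
qed

lemma expectation_edge_prod:
  assumes es_subset: "set es \<subseteq> V \<times> V"
  shows "expectation (edge_prod es) = (\<Prod>c\<in>(V \<times> V) // R. expectation (edge_prod (class_edges c es)))"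
proof -
  have "class_of ` set es \<subseteq> (V \<times> V) // R"
    using es_subset class_of_in_classes by auto
  then have "edge_prod es \<omega> = (\<Prod>c\<in>(V \<times> V) // R. edge_prod (class_edges c es) \<omega>)" for \<omega>
    unfolding edge_prod_def class_edges_def by (intro prod_list_map_partition[OF finite_classes])
  then have "expectation (edge_prod es)
      = expectation (\<lambda>\<omega>. \<Prod>c\<in>(V \<times> V) // R. edge_prod (class_edges c es) \<omega>)"
    by (rule Bochner_Integration.integral_cong[OF refl])
  also have "\<dots> = (\<Prod>c\<in>(V \<times> V) // R. expectation (edge_prod (class_edges c es)))"
    using es_subset by (intro indep_vars_lebesgue_integral finite_classes indep_vars_edge_prod_classes
        integrable_edge_prod) (auto simp: class_edges_def)
  finally show ?thesis .
qed

lemma expectation_edge_prod_isolated_class: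
  assumes es_subset: "set es \<subseteq> V \<times> V" and isolated: "count_list (map class_of es) c = 1"
  shows "expectation (edge_prod es) = 0"
proof -
  obtain i j where class_edges_eq: "class_edges c es = [(i, j)]"
    using isolated length_class_edges[of c es] by (auto simp: length_Suc_conv)
  then have "(i, j) \<in> {e \<in> set es. class_of e = c}"
    unfolding set_class_edges[symmetric] by simp
  then have ij_in_V: "i \<in> V" "j \<in> V" and "c \<in> (V \<times> V) // R"
    using es_subset class_of_in_classes by auto
  moreover have "edge_prod (class_edges c es) = X i j"
    by (simp add: class_edges_eq edge_prod_Cons edge_prod_Nil)
  then have "expectation (edge_prod (class_edges c es)) = 0"
    using X_mean[OF ij_in_V] by simp
  ultimately show ?thesis
    unfolding expectation_edge_prod[OF es_subset] using finite_classes by (intro prod_zero) auto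
qed

lemma expectation_edge_prod_matched:
  assumes es_subset: "set es \<subseteq> V \<times> V" and pair: "pair_word (map class_of es)"
    and matched: "\<And>c e e'. class_edges c es = [e, e'] \<Longrightarrow> e' = e \<or> e' = prod.swap e"
  shows "expectation (edge_prod es) = 1"
proof -
  have "expectation (edge_prod (class_edges c es)) = 1" for c
  proof (cases "c \<in> class_of ` set es")
    case False
    then have "class_edges c es = []"
      by (auto simp: class_edges_def filter_empty_conv)
    then show ?thesis
      by (simp add: edge_prod_Nil prob_space)
  next
    case True
    then have "length (class_edges c es) = Suc (Suc 0)"
      using pair by (auto simp: length_class_edges pair_word_def)
    then obtain i j e' where class_edges_eq: "class_edges c es = [(i, j), e']"
      by (auto simp: length_Suc_conv)
    then have "(i, j) \<in> {e \<in> set es. class_of e = c}"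
      unfolding set_class_edges[symmetric] by simp
    then have ij_in_V: "i \<in> V" "j \<in> V"
      using es_subset by auto
    have "edge_prod (class_edges c es) = (\<lambda>\<omega>. (X i j \<omega>)\<^sup>2)"
      using matched[OF class_edges_eq] X_commute[OF ij_in_V]
      by (auto simp: class_edges_eq edge_prod_Cons edge_prod_Nil power2_eq_square)
    then show ?thesis
      using X_variance[OF ij_in_V] by simp
  qed
  then show ?thesis
    unfolding expectation_edge_prod[OF es_subset] by simp
qed

lemma contour_matches_class_edges:
  assumes contour: "contour [] d p" and class_edges_eq: "class_edges c (edges p) = [e, e']"
  shows "e' = e \<or> e' = prod.swap e"
proof -
  let ?same = "\<lambda>g. undirected g = undirected e"
  have "e \<in> set (class_edges c (edges p))"
    by (simp add: class_edges_eq)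
  then have "class_of g = c" if "?same g" for g
    using that class_of_swap[of e] undirected_eq_iff[of e g] by (auto simp: set_class_edges)
  then have "filter ?same (edges p) = filter ?same (class_edges c (edges p))"
    unfolding class_edges_def filter_filter by (metis (no_types, lifting) filter_cong)
  then have "count_list (map undirected (edges p)) (undirected e) = length (filter ?same [e, e'])"
    by (simp add: count_list_map class_edges_eq)
  moreover have "parse [] d (map undirected (edges p))"
    using contour_parse[of undirected "[]" d p, OF undirected_commute] contour by simp
  then have "even (count_list (map undirected (edges p)) (undirected e))"
    using parse_even_count[of "[]" d "map undirected (edges p)" "undirected e"] by simp
  ultimately have "undirected e = undirected e'"
    by (auto split: if_splits)
  then show ?thesis
    unfolding undirected_eq_iff .
qed


subsection \<open>Expectations count contours\<close>

definition class_word :: "'v list \<Rightarrow> ('v \<times> 'v) set list" where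
  "class_word p = map class_of (edges p)"

lemma length_class_word: "p \<in> walks k \<Longrightarrow> length (class_word p) = k"
  by (simp add: class_word_def walks_length)

lemma parse_class_word: "contour [] d p \<Longrightarrow> parse [] d (class_word p)"
  using contour_parse[of class_of "[]" d p, OF class_of_commute] by (simp add: class_word_def)

lemma card_contours_pair_word:
  assumes pair: "pair_word (class_word p)" and "contour [] d p"
  shows "card (contours p) = 1"
proof -
  have "count_list (class_word p) a + count_list [] a \<le> 2" for a
    using pair by (cases "a \<in> set (class_word p)") (simp_all add: pair_word_def)
  then have "d' = d" if "contour [] d' p" for d'
    using parse_class_word[OF that] parse_class_word[OF assms(2)] by (rule parse_unique[rotated 2])
  then have "contours p = {d}"
    using assms(2) unfolding contours_def by blast
  then show ?thesis
    by simp
qed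

lemma label_wordE:
  assumes walk: "p \<in> walks k"
  obtains w where "w \<in> label_words k" "p \<in> coherent_walks w"
    "card (set w) = card (set (class_word p))"
    "pair_word (class_word p) \<Longrightarrow> pair_word w"
proof -
  have "card (set (class_word p)) \<le> card {..<k}"
    using card_length[of "class_word p"] length_class_word[OF walk] by simp
  then obtain f where relabel: "f ` set (class_word p) \<subseteq> {..<k}" "inj_on f (set (class_word p))"
    using card_le_inj[of "set (class_word p)" "{..<k}"] by auto
  define w where "w = map f (class_word p)"
  have "w \<in> label_words k"
    using relabel(1) length_class_word[OF walk] by (simp add: label_words_def w_def)
  moreover have "card (set w) = card (set (class_word p))"
    using relabel(2) by (simp add: w_def card_image)
  moreover have "pair_word w" if "pair_word (class_word p)"
    using that relabel(2) by (auto simp: pair_word_def w_def count_list_inj_map)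
  moreover have "coherent R (edges p) w"
  proof -
    have "(e, e') \<in> R"
      if e_in: "e \<in> set (edges p)" "e' \<in> set (edges p)"
        and "f (class_of e) = f (class_of e')" for e e'
    proof -
      have "class_of e = class_of e'"
        using that by (intro inj_onD[OF relabel(2)]) (auto simp: class_word_def)
      then show ?thesis
        using set_edges_walks[OF walk] e_in class_of_eq_iff by blast
    qed
    moreover have "set (zip (edges p) w) = (\<lambda>e. (e, f (class_of e))) ` set (edges p)"
      by (simp add: w_def class_word_def zip_map2 zip_same_conv_map image_image)
    ultimately show ?thesis
      unfolding coherent_def by (simp only: Set.ball_simps(9) prod.case) blast
  qed
  moreover have "length w = k"
    using length_class_word[OF walk] by (simp add: w_def)
  ultimately show thesis
    using walk by (intro that[of w]) (simp_all add: coherent_walks_def)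
qed

lemma pair_word_class_word:
  assumes walk: "p \<in> walks k" and "p \<notin> degenerate_walks k"
    and no_isolated: "\<And>c. count_list (class_word p) c \<noteq> 1"
  shows "pair_word (class_word p)"
proof (rule pair_wordI)
  fix a assume "a \<in> set (class_word p)"
  then have "count_list (class_word p) a \<noteq> 0"
    by (simp add: count_list_0_iff)
  with no_isolated[of a] show "2 \<le> count_list (class_word p) a"
    by linarith
next
  obtain w where label_word: "w \<in> label_words k" "p \<in> coherent_walks w"
    "card (set w) = card (set (class_word p))"
    using label_wordE[OF walk] by blast
  then have "\<not> 2 * card (set w) < k"
    using assms(2) unfolding degenerate_walks_def by blast
  then show "length (class_word p) \<le> 2 * card (set (class_word p))"
    by (simp add: label_word(3) length_class_word[OF walk])
qed

lemma contour_exists: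
  assumes walk: "p \<in> walks k" and "p \<notin> crossing_walks k" and "pair_word (class_word p)"
  shows "\<exists>d. contour [] d p"
proof -
  obtain w where "w \<in> label_words k" "p \<in> coherent_walks w" "pair_word w"
    using label_wordE[OF walk] assms(3) by blast
  then have "p \<in> coherent_walks w - noncontour_walks w"
    using assms(2) unfolding crossing_walks_def by blast
  then show ?thesis
    by (simp add: noncontour_walks_def)
qed

lemma expectation_eq_card_contours:
  assumes walk: "p \<in> walks k" and typical: "p \<notin> exceptional_walks k"
  shows "expectation (edge_prod (edges p)) = real (card (contours p))"
proof (cases "\<exists>c. count_list (class_word p) c = 1")
  case True
  then obtain c where isolated: "count_list (class_word p) c = 1" ..
  have "\<not> contour [] d p" for d
    using parse_even_count[OF parse_class_word, of d p c] isolated by auto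
  then have "contours p = {}"
    by (simp add: contours_def)
  then show ?thesis
    using expectation_edge_prod_isolated_class[OF set_edges_walks[OF walk], of c] isolated
    by (simp add: class_word_def)
next
  case False
  then have pair: "pair_word (class_word p)"
    using typical by (intro pair_word_class_word[OF walk]) (auto simp: exceptional_walks_def)
  then obtain d where contour: "contour [] d p"
    using typical contour_exists[OF walk] by (auto simp: exceptional_walks_def)
  have "expectation (edge_prod (edges p)) = 1"
    using pair contour_matches_class_edges[OF contour] set_edges_walks[OF walk]
    by (intro expectation_edge_prod_matched) (simp_all add: class_word_def)
  then show ?thesis
    using card_contours_pair_word[OF pair contour] by simp
qed

end


section \<open>Moments of edge ensembles\<close>

context edge_ensemble
begin

text \<open>The expected trace of the \<open>k\<close>-th power of the matrix with entries \<open>X i j\<close> for adjacent \<open>i\<close> and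
  \<open>j\<close>, and \<open>0\<close> elsewhere.\<close>

definition trace_moment :: "nat \<Rightarrow> real" where
  "trace_moment k = (\<Sum>p\<in>closed_walks k. expectation (edge_prod (edges p)))"

lemma abs_trace_moment_minus_contours_le:
  assumes moment_le: "\<And>i j. i \<in> V \<Longrightarrow> j \<in> V \<Longrightarrow> expectation (\<lambda>\<omega>. \<bar>X i j \<omega>\<bar> ^ k) \<le> C"
    and "0 \<le> C"
  shows "\<bar>trace_moment k - (\<Sum>p\<in>closed_walks k. real (card (contours p)))\<bar>
    \<le> (1 + real k * C + real (card (dyck_words k 0))) * real (card (exceptional_walks k))"
proof -
  let ?B = "1 + real k * C + real (card (dyck_words k 0))"
  define err where "err p = expectation (edge_prod (edges p)) - real (card (contours p))" for p
  have err_le: "\<bar>err p\<bar> \<le> ?B" if "p \<in> walks k" for p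
  proof -
    have "\<bar>expectation (edge_prod (edges p))\<bar> \<le> 1 + real k * C"
      using abs_expectation_edge_prod_le[of "edges p" C] moment_le set_edges_walks[OF that]
        walks_length[OF that] by simp
    moreover have "card (contours p) \<le> card (dyck_words k 0)"
      using contours_eq[OF walks_length[OF that]] by (intro card_mono) auto
    ultimately show ?thesis
      by (simp add: err_def abs_le_iff)
  qed
  have err_0: "err p = 0" if "p \<in> closed_walks k - exceptional_walks k" for p
    using that expectation_eq_card_contours by (auto simp: err_def closed_walks_def)
  have "\<bar>\<Sum>p\<in>closed_walks k. err p\<bar> = \<bar>\<Sum>p\<in>closed_walks k \<inter> exceptional_walks k. err p\<bar>"
    using err_0 by (intro arg_cong[of _ _ abs] sum.mono_neutral_right) auto
  also have "\<dots> \<le> (\<Sum>p\<in>closed_walks k \<inter> exceptional_walks k. ?B)"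
    using err_le by (intro order_trans[OF sum_abs] sum_mono) (simp add: closed_walks_def)
  also have "\<dots> = ?B * real (card (closed_walks k \<inter> exceptional_walks k))"
    by simp
  also have "\<dots> \<le> ?B * real (card (exceptional_walks k))"
    using \<open>0 \<le> C\<close> by (intro mult_left_mono) (simp_all add: card_mono)
  finally show ?thesis
    by (simp add: trace_moment_def err_def sum_subtractf)
qed

theorem abs_trace_moment_minus_dyck_le:
  assumes "V \<noteq> {}"
    and moment_le: "\<And>i j. i \<in> V \<Longrightarrow> j \<in> V \<Longrightarrow> expectation (\<lambda>\<omega>. \<bar>X i j \<omega>\<bar> ^ k) \<le> C"
  shows "\<bar>trace_moment k / (real (card V) * sqrt (real \<Delta>) ^ k) - real (card (dyck_words k 0))\<bar>
    \<le> (1 + real k * C + real (card (dyck_words k 0))) * exceptional_rate k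
      + real (card (dyck_words k 0)) * (1 - real (card (regular_interior k)) / real (card V))"
    (is "\<bar>?moment - ?n\<bar> \<le> ?B * _ + ?boundary")
proof -
  let ?t = "real (card V) * sqrt (real \<Delta>) ^ k"
  let ?G = "\<Sum>p\<in>closed_walks k. real (card (contours p))"
  obtain v where "v \<in> V"
    using assms(1) by blast
  have "0 \<le> expectation (\<lambda>\<omega>. \<bar>X v v \<omega>\<bar> ^ k)"
    by (intro integral_nonneg_AE) simp
  then have "0 \<le> C"
    using moment_le[OF \<open>v \<in> V\<close> \<open>v \<in> V\<close>] by linarith
  have "\<bar>?moment - ?G / ?t\<bar> = \<bar>trace_moment k - ?G\<bar> / ?t"
    by (simp add: abs_divide abs_mult flip: diff_divide_distrib)
  also have "\<dots> \<le> ?B * real (card (exceptional_walks k)) / ?t"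
    using abs_trace_moment_minus_contours_le[OF moment_le \<open>0 \<le> C\<close>]
    by (intro divide_right_mono) simp_all
  also have "\<dots> \<le> ?B * exceptional_rate k"
    unfolding times_divide_eq_right[symmetric] using \<open>0 \<le> C\<close>
    by (intro mult_left_mono card_exceptional_walks_fraction_le assms(1)) simp
  finally have "\<bar>?moment - ?G / ?t\<bar> \<le> ?B * exceptional_rate k" .
  moreover have "\<bar>?G / ?t - ?n\<bar> \<le> ?boundary"
    by (rule sum_card_contours_fraction[OF assms(1)])
  moreover have "\<bar>?moment - ?n\<bar> \<le> \<bar>?moment - ?G / ?t\<bar> + \<bar>?G / ?t - ?n\<bar>"
    using abs_triangle_ineq[of "?moment - ?G / ?t" "?G / ?t - ?n"] by simp
  ultimately show ?thesis
    by (meson add_mono order_trans)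
qed

end

theorem trace_moment_tendsto:
  fixes V :: "'n \<Rightarrow> 'v set" and R :: "'n \<Rightarrow> (('v \<times> 'v) \<times> 'v \<times> 'v) set" and C :: real
  assumes ensemble: "\<And>n. edge_ensemble (V n) (adj n) (\<Delta> n) (R n) K (M n) (X n)"
    and nonempty: "\<forall>\<^sub>F n in F. V n \<noteq> {}"
    and degree: "filterlim \<Delta> at_top F"
    and interior: "((\<lambda>n. real (card (bounded_degree_graph.regular_interior (V n) (adj n) (\<Delta> n) k))
        / real (card (V n))) \<longlongrightarrow> 1) F"
    and turns: "((\<lambda>n. real (card (turns (V n) (R n))) / (real (card (V n)) * real (\<Delta> n))) \<longlongrightarrow> 0) F"
    and collisions: "((\<lambda>n. real (max_collisions (V n) (R n)) / (real (\<Delta> n))\<^sup>2) \<longlongrightarrow> 0) F"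
    and moments: "\<And>n i j. i \<in> V n \<Longrightarrow> j \<in> V n \<Longrightarrow>
        prob_space.expectation (M n) (\<lambda>\<omega>. \<bar>X n i j \<omega>\<bar> ^ k) \<le> C"
  shows "((\<lambda>n. edge_ensemble.trace_moment (V n) (adj n) (M n) (X n) k
      / (real (card (V n)) * sqrt (real (\<Delta> n)) ^ k)) \<longlongrightarrow> real (card (dyck_words k 0))) F"
proof (rule LIM_zero_cancel, rule Lim_null_comparison)
  let ?D = "real (card (dyck_words k 0))"
  let ?rate = "\<lambda>n. edge_relation.exceptional_rate (V n) (\<Delta> n) (R n) K k"
  let ?fraction = "\<lambda>n. real (card (bounded_degree_graph.regular_interior (V n) (adj n) (\<Delta> n) k))
    / real (card (V n))"
  let ?err = "\<lambda>n. (1 + real k * C + ?D) * ?rate n + ?D * (1 - ?fraction n)"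
  show "\<forall>\<^sub>F n in F. norm (edge_ensemble.trace_moment (V n) (adj n) (M n) (X n) k
      / (real (card (V n)) * sqrt (real (\<Delta> n)) ^ k) - ?D) \<le> ?err n"
    using nonempty
  proof eventually_elim
    case (elim n)
    show ?case
      unfolding real_norm_def
      by (rule edge_ensemble.abs_trace_moment_minus_dyck_le[OF ensemble elim moments])
  qed
  have "filterlim (\<lambda>n. sqrt (real (\<Delta> n))) at_top F"
    by (intro filterlim_compose[OF sqrt_at_top] filterlim_compose[OF filterlim_real_sequentially]
        degree)
  then have "((\<lambda>n. 1 / sqrt (real (\<Delta> n))) \<longlongrightarrow> 0) F"
    by (intro real_tendsto_divide_at_top[OF tendsto_const])
  then have "(?rate \<longlongrightarrow> (real k * real K) ^ k * (0 + real k * (0 + 0))) F"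
    unfolding edge_relation.exceptional_rate_def[OF edge_ensemble.axioms(1)[OF ensemble]]
    by (intro tendsto_intros turns collisions)
  then have "(?err \<longlongrightarrow> (1 + real k * C + ?D) * 0 + ?D * (1 - 1)) F"
    by (intro tendsto_intros interior) simp
  then show "(?err \<longlongrightarrow> 0) F"
    by simp
qed


section \<open>Band matrices\<close>

declare One_nat_def [simp del]

definition near :: "nat \<Rightarrow> nat \<Rightarrow> nat \<Rightarrow> bool" where
  "near b i j \<longleftrightarrow> \<bar>int i - int j\<bar> \<le> int b"

lemma bounded_degree_graph_near: "bounded_degree_graph {1..N} (near b) (2 * b + 1)"
proof
  fix v assume "v \<in> {1..N}"
  have "card {x \<in> {1..N}. near b v x} \<le> card {v - b..v + b}"
    by (intro card_mono) (auto simp: near_def)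
  then show "card {x \<in> {1..N}. near b v x} \<le> 2 * b + 1"
    by simp
qed (auto simp: near_def)

lemma regular_interior_near_superset:
  "{v. k * b < v \<and> v + k * b \<le> N}
     \<subseteq> bounded_degree_graph.regular_interior {1..N} (near b) (2 * b + 1) k"
proof -
  interpret bounded_degree_graph "{1..N}" "near b" "2 * b + 1"
    by (rule bounded_degree_graph_near)
  show ?thesis
  proof (induction k)
    case (Suc k)
    show ?case
    proof
      fix v assume "v \<in> {v. Suc k * b < v \<and> v + Suc k * b \<le> N}"
      then have inner: "b + k * b < v" "v + b + k * b \<le> N"
        by simp_all
      have "neighbours v = {v - b..v + b}"
        using inner by (auto simp: neighbours_def near_def)
      moreover from this have "neighbours v \<subseteq> regular_interior k"
        using inner by (intro order_trans[OF _ Suc.IH]) auto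
      ultimately show "v \<in> regular_interior (Suc k)"
        using inner by simp
    qed
  qed auto
qed

lemma regular_interior_near_tendsto:
  assumes "(\<lambda>N. real (b N)) \<in> o(\<lambda>N. real N)"
  shows "(\<lambda>N. real (card (bounded_degree_graph.regular_interior {1..N} (near (b N)) (2 * b N + 1) k))
    / real (card {1..N})) \<longlonglongrightarrow> 1"
    (is "(\<lambda>N. real (card (?I N)) / _) \<longlonglongrightarrow> 1")
proof (rule tendsto_sandwich)
  have subset: "?I N \<subseteq> {1..N}" for N
    by (rule bounded_degree_graph.regular_interior_subset[OF bounded_degree_graph_near])
  show "\<forall>\<^sub>F N in sequentially.
      1 - 2 * real k * (real (b N) / real N) \<le> real (card (?I N)) / real (card {1..N})"
    using eventually_gt_at_top[of 0]
  proof eventually_elim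
    case (elim N)
    have "{k * b N + 1..N - k * b N} \<subseteq> ?I N"
      by (rule order_trans[OF _ regular_interior_near_superset]) auto
    then have "card {k * b N + 1..N - k * b N} \<le> card (?I N)"
      by (rule card_mono[OF finite_subset[OF subset finite_atLeastAtMost]])
    then have "real (N - 2 * (k * b N)) \<le> real (card (?I N))"
      by simp
    then have "real N - 2 * real k * real (b N) \<le> real (card (?I N))"
      by (simp add: of_nat_diff_real)
    then have "(real N - 2 * real k * real (b N)) / real N \<le> real (card (?I N)) / real N"
      by (rule divide_right_mono) simp
    with elim show ?case
      by (simp add: diff_divide_distrib)
  qed
  show "\<forall>\<^sub>F N in sequentially. real (card (?I N)) / real (card {1..N}) \<le> 1"
    using card_mono[OF _ subset] by (auto simp: divide_le_eq_1 intro!: always_eventually)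
  have "(\<lambda>N. 1 - 2 * real k * (real (b N) / real N)) \<longlonglongrightarrow> 1 - 2 * real k * 0"
    by (intro tendsto_intros smalloD_tendsto[OF assms])
  then show "(\<lambda>N. 1 - 2 * real k * (real (b N) / real N)) \<longlonglongrightarrow> 1"
    by simp
qed simp

lemma sqmat_pow_eq_sum_walks:
  assumes graph: "finite_graph {1..N} adj" and supp: "\<And>x y. \<not> adj x y \<Longrightarrow> A x y = 0"
    and i_in: "i \<in> {1..N}"
  shows "j \<in> {1..N} \<Longrightarrow> sqmat_pow N A k i j
    = (\<Sum>p | p \<in> finite_graph.walks_from {1..N} adj i k \<and> last p = j.
        prod_list (map (\<lambda>(x, y). A x y) (edges p)))"
proof (induction k arbitrary: j)
  case 0
  have "{p. p \<in> finite_graph.walks_from {1..N} adj i 0 \<and> last p = j}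
      = (if i = j then {[i]} else {})"
    by (auto simp only: finite_graph.walks_from_0[OF graph i_in] last_ConsL split: if_splits)
  then show ?case
    by simp
next
  case (Suc k)
  interpret finite_graph "{1..N}" adj
    by (rule graph)
  let ?w = "\<lambda>p. prod_list (map (\<lambda>(x, y). A x y) (edges p))"
  have snoc: "?w (p @ [j]) = ?w p * A (last p) j" if "p \<in> walks_from i k" for p
    using that by (cases "p = []") (auto simp: walks_from_def edges_snoc)
  have "sqmat_pow N A (Suc k) i j
      = (\<Sum>l\<in>{1..N}. (\<Sum>p | p \<in> walks_from i k \<and> last p = l. ?w p) * A l j)"
    using Suc.IH by (simp add: sqmat_mult_def)
  also have "\<dots> = (\<Sum>l\<in>{1..N}. \<Sum>p | p \<in> walks_from i k \<and> last p = l. ?w p * A (last p) j)"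
    by (simp add: sum_distrib_right)
  also have "\<dots> = (\<Sum>p\<in>walks_from i k. ?w p * A (last p) j)"
    by (rule sum_walks_from_group_last)
  also have "\<dots> = (\<Sum>p | p \<in> walks_from i k \<and> adj (last p) j. ?w p * A (last p) j)"
    using supp by (intro sum.mono_neutral_right) auto
  also have "\<dots> = (\<Sum>p | p \<in> walks_from i (Suc k) \<and> last p = j. ?w p)"
    unfolding sum_walks_from_Suc_last[OF Suc.prems] by (intro sum.cong refl) (simp add: snoc)
  finally show ?case .
qed

lemma sqmat_trace_pow_eq_sum_closed_walks:
  assumes graph: "finite_graph {1..N} adj" and supp: "\<And>x y. \<not> adj x y \<Longrightarrow> A x y = 0"
  shows "sqmat_trace N (sqmat_pow N A k)
    = (\<Sum>p\<in>finite_graph.closed_walks {1..N} adj k. prod_list (map (\<lambda>(x, y). A x y) (edges p)))"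
  unfolding sqmat_trace_def finite_graph.sum_closed_walks[OF graph]
  by (intro sum.cong refl sqmat_pow_eq_sum_walks[OF graph supp])

lemma expectation_trace_band_matrix:
  assumes "edge_ensemble {1..N} (near b) (2 * b + 1) R K M X"
  shows "prob_space.expectation M
      (\<lambda>\<omega>. sqmat_trace N (sqmat_pow N (band_matrix b (\<lambda>i j. X i j \<omega>)) k))
    = edge_ensemble.trace_moment {1..N} (near b) M X k / sqrt (2 * real b) ^ k"
proof -
  interpret edge_ensemble "{1..N}" "near b" "2 * b + 1" R K M X
    by fact
  let ?A = "\<lambda>\<omega>. band_matrix b (\<lambda>i j. X i j \<omega>)"
  have entry: "?A \<omega> x y = (if near b x y then X x y \<omega> else 0) / sqrt (2 * real b)" for \<omega> x y
    by (simp add: band_matrix_def near_def)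
  have scale: "(\<forall>(x, y)\<in>set es. near b x y) \<Longrightarrow> prod_list (map (\<lambda>(x, y). ?A \<omega> x y) es)
      = edge_prod es \<omega> / sqrt (2 * real b) ^ length es" for es \<omega>
    by (induction es) (auto simp: entry edge_prod_def)
  have "sqmat_trace N (sqmat_pow N (?A \<omega>) k)
      = (\<Sum>p\<in>closed_walks k. edge_prod (edges p) \<omega> / sqrt (2 * real b) ^ k)" for \<omega>
  proof -
    have "prod_list (map (\<lambda>(x, y). ?A \<omega> x y) (edges p))
        = edge_prod (edges p) \<omega> / sqrt (2 * real b) ^ k"
      if "p \<in> closed_walks k" for p
      using that scale[of "edges p" \<omega>]
      by (simp add: closed_walks_def walks_def successively_edges_iff)
    then show ?thesis
      by (simp add: sqmat_trace_pow_eq_sum_closed_walks[OF finite_graph_axioms] entry)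
  qed
  moreover have "integrable M (edge_prod (edges p))" if "p \<in> closed_walks k" for p
    using that set_edges_walks by (intro integrable_edge_prod) (auto simp: closed_walks_def)
  ultimately show ?thesis
    by (simp add: trace_moment_def sum_divide_distrib)
qed

lemma band_width_square_bigo:
  fixes b :: "nat \<Rightarrow> nat"
  shows "(\<lambda>N. (real (b N))\<^sup>2) \<in> O(\<lambda>N. (real (2 * b N + 1))\<^sup>2)"
    and "(\<lambda>N. real (b N)) \<in> o(\<lambda>N. real N) \<Longrightarrow>
      (\<lambda>N. (real (b N))\<^sup>2) \<in> O(\<lambda>N. real (card {1..N}) * real (2 * b N + 1))"
proof -
  have width: "(\<lambda>N. real (b N)) \<in> O(\<lambda>N. real (2 * b N + 1))"
    by (rule bigoI[of _ 1]) simp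
  then show "(\<lambda>N. (real (b N))\<^sup>2) \<in> O(\<lambda>N. (real (2 * b N + 1))\<^sup>2)"
    by (rule landau_o.big_power)
  assume "(\<lambda>N. real (b N)) \<in> o(\<lambda>N. real N)"
  then have "(\<lambda>N. real (b N)) \<in> O(\<lambda>N. real (card {1..N}))"
    by (simp add: landau_o.small_imp_big)
  from landau_o.big.mult[OF this width]
  show "(\<lambda>N. (real (b N))\<^sup>2) \<in> O(\<lambda>N. real (card {1..N}) * real (2 * b N + 1))"
    by (simp add: power2_eq_square)
qed

lemma band_normalisation_tendsto:
  assumes "filterlim b at_top sequentially"
  shows "(\<lambda>N. (sqrt (real (2 * b N + 1)) / sqrt (2 * real (b N))) ^ k) \<longlonglongrightarrow> 1"
proof -
  have "filterlim (\<lambda>N. real (b N)) at_top sequentially"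
    by (rule filterlim_compose[OF filterlim_real_sequentially assms])
  moreover have "((\<lambda>x::real. (sqrt (2 * x + 1) / sqrt (2 * x)) ^ k) \<longlongrightarrow> 1 ^ k) at_top"
    by (rule tendsto_power) real_asymp
  ultimately show ?thesis
    using filterlim_compose by fastforce
qed


theorem expectation_trace_band_matrix_tendsto:
  fixes R :: "nat \<Rightarrow> ((nat \<times> nat) \<times> nat \<times> nat) set" and C :: real
  assumes ensemble: "\<And>N. edge_ensemble {1..N} (near (b N)) (2 * b N + 1) (R N) K (M N) (X N)"
    and b_inf: "filterlim b at_top at_top"
    and b_small: "(\<lambda>N. real (b N)) \<in> o(\<lambda>N. real N)"
    and collisions: "(\<lambda>N. real (max_collisions {1..N} (R N))) \<in> o(\<lambda>N. (real (b N))\<^sup>2)"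
    and turns: "(\<lambda>N. real (card (turns {1..N} (R N)))) \<in> o(\<lambda>N. (real (b N))\<^sup>2)"
    and moments: "\<And>N i j. i \<in> {1..N} \<Longrightarrow> j \<in> {1..N} \<Longrightarrow>
        prob_space.expectation (M N) (\<lambda>\<omega>. \<bar>X N i j \<omega>\<bar> ^ k) \<le> C"
  shows "(\<lambda>N. prob_space.expectation (M N)
        (\<lambda>\<omega>. sqmat_trace N (sqmat_pow N (band_matrix (b N) (\<lambda>i j. X N i j \<omega>)) k)) / real N)
    \<longlonglongrightarrow> real (card (dyck_words k 0))"
proof -
  have "(\<lambda>N. edge_ensemble.trace_moment {1..N} (near (b N)) (M N) (X N) k
      / (real (card {1..N}) * sqrt (real (2 * b N + 1)) ^ k)) \<longlonglongrightarrow> real (card (dyck_words k 0))"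
  proof (rule trace_moment_tendsto[OF ensemble _ _ regular_interior_near_tendsto[OF b_small]])
    show "\<forall>\<^sub>F N in sequentially. {1..N} \<noteq> {}"
      by (rule eventually_sequentiallyI[of 1]) simp
    show "filterlim (\<lambda>N. 2 * b N + 1) at_top sequentially"
      by (rule filterlim_at_top_mono[OF b_inf]) simp
    show "(\<lambda>N. real (card (turns {1..N} (R N))) / (real (card {1..N}) * real (2 * b N + 1))) \<longlonglongrightarrow> 0"
      by (rule smalloD_tendsto[OF landau_o.small_big_trans[OF turns
            band_width_square_bigo(2)[OF b_small]]])
    show "(\<lambda>N. real (max_collisions {1..N} (R N)) / (real (2 * b N + 1))\<^sup>2) \<longlonglongrightarrow> 0"
      by (rule smalloD_tendsto[OF landau_o.small_big_trans[OF collisions band_width_square_bigo(1)]])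
  qed (rule moments)
  from tendsto_mult[OF this band_normalisation_tendsto[OF b_inf, of k]] show ?thesis
    by (simp add: expectation_trace_band_matrix[OF ensemble] power_divide mult_ac)
qed

theorem mainTheorem14:
  fixes b :: "nat \<Rightarrow> nat"
    and R :: "nat \<Rightarrow> ((nat \<times> nat) \<times> (nat \<times> nat)) set"
    and M :: "nat \<Rightarrow> 'a measure"
    and X :: "nat \<Rightarrow> nat \<Rightarrow> nat \<Rightarrow> 'a \<Rightarrow> real"
    and k :: nat
  assumes b_pos: "\<And>N. b N > 0"
    and b_inf: "filterlim b at_top at_top"
    and b_small: "(\<lambda>N. real (b N)) \<in> o(\<lambda>N. real N)"
    and R_equiv: "\<And>N. equiv ({1..N} \<times> {1..N}) (R N)"
    and R_sym: "\<And>N p q. p \<in> {1..N} \<Longrightarrow> q \<in> {1..N} \<Longrightarrow> ((p, q), (q, p)) \<in> R N"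
    and O1: "(\<lambda>N. real (Max ((\<lambda>p. card {(q, r, s). q \<in> {1..N} \<and> r \<in> {1..N} \<and> s \<in> {1..N}
                                   \<and> ((p, q), (r, s)) \<in> R N}) ` {1..N})))
             \<in> o(\<lambda>N. (real (b N))\<^sup>2)"
    and O2: "\<exists>B::nat. \<forall>N. \<forall>p\<in>{1..N}. \<forall>q\<in>{1..N}. \<forall>r\<in>{1..N}.
               card {s \<in> {1..N}. ((p, q), (r, s)) \<in> R N} \<le> B"
    and O3: "(\<lambda>N. real (card {(p, q, r). p \<in> {1..N} \<and> q \<in> {1..N} \<and> r \<in> {1..N}
                                   \<and> ((p, q), (q, r)) \<in> R N \<and> r \<noteq> p}))
             \<in> o(\<lambda>N. (real (b N))\<^sup>2)"
    and prob: "\<And>N. prob_space (M N)"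
    and meas: "\<And>N i j. i \<in> {1..N} \<Longrightarrow> j \<in> {1..N} \<Longrightarrow> X N i j \<in> borel_measurable (M N)"
    and X_sym: "\<And>N i j. i \<in> {1..N} \<Longrightarrow> j \<in> {1..N} \<Longrightarrow> X N i j = X N j i"
    and X_mean: "\<And>N i j. i \<in> {1..N} \<Longrightarrow> j \<in> {1..N} \<Longrightarrow>
                   prob_space.expectation (M N) (X N i j) = 0"
    and X_var: "\<And>N i j. i \<in> {1..N} \<Longrightarrow> j \<in> {1..N} \<Longrightarrow>
                   prob_space.expectation (M N) (\<lambda>\<omega>. (X N i j \<omega>)\<^sup>2) = 1"
    and X_int: "\<And>N i j m. i \<in> {1..N} \<Longrightarrow> j \<in> {1..N} \<Longrightarrow>
                   integrable (M N) (\<lambda>\<omega>. \<bar>X N i j \<omega>\<bar> ^ m)"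
    and X_moments: "\<And>m. \<exists>C. \<forall>N. \<forall>i\<in>{1..N}. \<forall>j\<in>{1..N}.
                   prob_space.expectation (M N) (\<lambda>\<omega>. \<bar>X N i j \<omega>\<bar> ^ m) \<le> C"
    and X_indep: "\<And>N. prob_space.indep_vars (M N) (\<lambda>C. PiM C (\<lambda>_. borel))
                   (\<lambda>C \<omega>. restrict (\<lambda>(p, q). X N p q \<omega>) C)
                   (({1..N} \<times> {1..N}) // R N)"
  shows "(\<lambda>N. prob_space.expectation (M N)
                 (\<lambda>\<omega>. sqmat_trace N (sqmat_pow N (band_matrix (b N) (\<lambda>i j. X N i j \<omega>)) k))
               / real N)
         \<longlonglongrightarrow> (if even k then catalan (k div 2) else 0)"
proof -
  obtain B where B: "\<forall>N. \<forall>p\<in>{1..N}. \<forall>q\<in>{1..N}. \<forall>r\<in>{1..N}.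
      card {s \<in> {1..N}. ((p, q), (r, s)) \<in> R N} \<le> B"
    using O2 by blast
  obtain C where C: "\<forall>N. \<forall>i\<in>{1..N}. \<forall>j\<in>{1..N}.
      prob_space.expectation (M N) (\<lambda>\<omega>. \<bar>X N i j \<omega>\<bar> ^ k) \<le> C"
    using X_moments by blast
  have "edge_ensemble {1..N} (near (b N)) (2 * b N + 1) (R N) (Suc B) (M N) (X N)" for N
    using R_equiv R_sym B prob meas X_sym X_mean X_var X_int X_indep
    by (intro edge_ensemble.intro edge_relation.intro edge_relation_axioms.intro
        edge_ensemble_axioms.intro bounded_degree_graph_near) (auto intro: le_SucI)
  moreover have "(\<lambda>N. real (max_collisions {1..N} (R N))) \<in> o(\<lambda>N. (real (b N))\<^sup>2)"
    using O1 by (simp only: max_collisions_def collisions_def)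
  moreover have "(\<lambda>N. real (card (turns {1..N} (R N)))) \<in> o(\<lambda>N. (real (b N))\<^sup>2)"
    using O3 by (simp only: turns_def)
  ultimately show ?thesis
    unfolding card_dyck_words_eq_catalan_if[symmetric]
    using b_inf b_small C by (intro expectation_trace_band_matrix_tendsto[where C = C]) blast+
qed

end
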